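(* Let $(T_1,\dots,T_k)$ be a tuple of contractions on a Hilbert space $\mathcal{H}$ and $q_{ij}\in\mathbb{T}$ ($1\le i<j\le k$) such that $T_iT_j=q_{ij}T_jT_i$ and $T_iT_j^*=\overline{q_{ij}}\,T_j^*T_i$ for $1\le i<j\le k$. Then there exist a Hilbert space $\mathcal{K}\supseteq\mathcal{H}$, a commuting family $\{Q_{ij}:1\le i<j\le k\}$ of unitaries on $\mathcal{K}$ and unitaries $U_1,\dots,U_k$ on $\mathcal{K}$ with $U_iU_j=Q_{ij}U_jU_i$ for $i<j$ and $Q_{ij}U_m=U_mQ_{ij}$ for all $i<j$ and all $m$, such that \[ T_1(m_1)\cdots T_k(m_k)=P_{\mathcal{H}}U_1^{m_1}\cdots U_k^{m_k}|_{\mathcal{H}} \] for all $m_1,\dots,m_k\in\mathbb{Z}$. Moreover, the $Q_{ij}$ can be chosen of the form $Q_{ij}=q_{ij}I\oplus\widetilde{Q}_{ij}$ with respect to $\mathcal{K}=\mathcal{H}\oplus\mathcal{H}^\perp$, for some unitaries $\widetilde{Q}_{ij}$ on $\mathcal{H}^\perp$.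
   Context: For a contraction $C$ and $m\in\mathbb{Z}$: $C(m)=C^m$ if $m\ge1$, $C(0)=I$, and $C(m)=(C^* )^{|m|}$ if $m<0$. $P_{\mathcal{H}}$ denotes the orthogonal projection of $\mathcal{K}$ onto $\mathcal{H}$. *)

theory Defs
  imports Complex_Main
begin

record 'a hspace =
  hcarrier :: "'a set"
  hzero    :: 'a
  hadd     :: "'a \<Rightarrow> 'a \<Rightarrow> 'a"
  hscale   :: "complex \<Rightarrow> 'a \<Rightarrow> 'a"
  hinner   :: "'a \<Rightarrow> 'a \<Rightarrow> complex"

definition hminus :: "'a hspace \<Rightarrow> 'a \<Rightarrow> 'a \<Rightarrow> 'a" where
  "hminus V x y = hadd V x (hscale V (-1) y)"

definition hnorm :: "'a hspace \<Rightarrow> 'a \<Rightarrow> real" where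
  "hnorm V x = sqrt (Re (hinner V x x))"

definition hilbert_space :: "'a hspace \<Rightarrow> bool" where
  "hilbert_space V \<longleftrightarrow>
     (let C = hcarrier V in
      hzero V \<in> C \<and>
      (\<forall>x\<in>C. \<forall>y\<in>C. hadd V x y \<in> C) \<and>
      (\<forall>c. \<forall>x\<in>C. hscale V c x \<in> C) \<and>
      (\<forall>x\<in>C. \<forall>y\<in>C. \<forall>z\<in>C. hadd V (hadd V x y) z = hadd V x (hadd V y z)) \<and>
      (\<forall>x\<in>C. \<forall>y\<in>C. hadd V x y = hadd V y x) \<and>
      (\<forall>x\<in>C. hadd V (hzero V) x = x) \<and>
      (\<forall>x\<in>C. \<exists>y\<in>C. hadd V x y = hzero V) \<and>
      (\<forall>c. \<forall>x\<in>C. \<forall>y\<in>C. hscale V c (hadd V x y) = hadd V (hscale V c x) (hscale V c y)) \<and>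
      (\<forall>a b. \<forall>x\<in>C. hscale V (a + b) x = hadd V (hscale V a x) (hscale V b x)) \<and>
      (\<forall>a b. \<forall>x\<in>C. hscale V (a * b) x = hscale V a (hscale V b x)) \<and>
      (\<forall>x\<in>C. hscale V 1 x = x) \<and>
      (\<forall>x\<in>C. \<forall>y\<in>C. \<forall>z\<in>C. hinner V (hadd V x y) z = hinner V x z + hinner V y z) \<and>
      (\<forall>c. \<forall>x\<in>C. \<forall>y\<in>C. hinner V (hscale V c x) y = c * hinner V x y) \<and>
      (\<forall>x\<in>C. \<forall>y\<in>C. hinner V x y = cnj (hinner V y x)) \<and>
      (\<forall>x\<in>C. 0 \<le> Re (hinner V x x)) \<and>
      (\<forall>x\<in>C. hinner V x x = 0 \<longrightarrow> x = hzero V) \<and>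
      (\<forall>f :: nat \<Rightarrow> 'a. (\<forall>n. f n \<in> C) \<and>
          (\<forall>e>0. \<exists>N. \<forall>m\<ge>N. \<forall>n\<ge>N. hnorm V (hminus V (f m) (f n)) < e)
          \<longrightarrow> (\<exists>l\<in>C. (\<lambda>n. hnorm V (hminus V (f n) l)) \<longlonglongrightarrow> 0)))"

definition bounded_op :: "'a hspace \<Rightarrow> ('a \<Rightarrow> 'a) \<Rightarrow> bool" where
  "bounded_op V T \<longleftrightarrow>
     (\<forall>x\<in>hcarrier V. T x \<in> hcarrier V) \<and>
     (\<forall>x\<in>hcarrier V. \<forall>y\<in>hcarrier V. T (hadd V x y) = hadd V (T x) (T y)) \<and>
     (\<forall>c. \<forall>x\<in>hcarrier V. T (hscale V c x) = hscale V c (T x)) \<and>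
     (\<exists>B. \<forall>x\<in>hcarrier V. hnorm V (T x) \<le> B * hnorm V x)"

definition contraction :: "'a hspace \<Rightarrow> ('a \<Rightarrow> 'a) \<Rightarrow> bool" where
  "contraction V T \<longleftrightarrow> bounded_op V T \<and> (\<forall>x\<in>hcarrier V. hnorm V (T x) \<le> hnorm V x)"

text \<open>The Hilbert space adjoint T* (determined on the carrier).\<close>
definition hadj :: "'a hspace \<Rightarrow> ('a \<Rightarrow> 'a) \<Rightarrow> ('a \<Rightarrow> 'a)" where
  "hadj V T = (SOME S. bounded_op V S \<and>
      (\<forall>x\<in>hcarrier V. \<forall>y\<in>hcarrier V. hinner V (T x) y = hinner V x (S y)))"

definition unitary :: "'a hspace \<Rightarrow> ('a \<Rightarrow> 'a) \<Rightarrow> bool" where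
  "unitary V U \<longleftrightarrow> bounded_op V U \<and>
     (\<forall>x\<in>hcarrier V. hadj V U (U x) = x \<and> U (hadj V U x) = x)"

text \<open>C(m): C^m for m \<ge> 1, I for m = 0, (C*)^|m| for m < 0.  For a unitary U this is
exactly U^m, since U^{-1} = U*.\<close>
definition opow :: "'a hspace \<Rightarrow> ('a \<Rightarrow> 'a) \<Rightarrow> int \<Rightarrow> ('a \<Rightarrow> 'a)" where
  "opow V C m = (if 0 \<le> m then C ^^ nat m else hadj V C ^^ nat (- m))"

definition opprod :: "nat \<Rightarrow> (nat \<Rightarrow> ('a \<Rightarrow> 'a)) \<Rightarrow> ('a \<Rightarrow> 'a)" where
  "opprod k F = foldr (\<lambda>i acc. F i \<circ> acc) [1..<k+1] id"

definition hproj :: "'a hspace \<Rightarrow> 'a set \<Rightarrow> 'a \<Rightarrow> 'a" where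
  "hproj V S z = (SOME p. p \<in> S \<and> (\<forall>s\<in>S. hinner V (hminus V z p) s = 0))"

definition isometric_embedding :: "'a hspace \<Rightarrow> 'b hspace \<Rightarrow> ('a \<Rightarrow> 'b) \<Rightarrow> bool" where
  "isometric_embedding H K J \<longleftrightarrow>
     (\<forall>x\<in>hcarrier H. J x \<in> hcarrier K) \<and>
     (\<forall>x\<in>hcarrier H. \<forall>y\<in>hcarrier H. J (hadd H x y) = hadd K (J x) (J y)) \<and>
     (\<forall>c. \<forall>x\<in>hcarrier H. J (hscale H c x) = hscale K c (J x)) \<and>
     (\<forall>x\<in>hcarrier H. \<forall>y\<in>hcarrier H. hinner K (J x) (J y) = hinner H x y)"

definition perp_space :: "'b hspace \<Rightarrow> 'b set \<Rightarrow> 'b hspace" where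
  "perp_space K S = K\<lparr>hcarrier := {z \<in> hcarrier K. \<forall>s\<in>S. hinner K z s = 0}\<rparr>"

end

theory Submission
  imports Defs "HOL-Analysis.Infinite_Sum" "HOL-Computational_Algebra.Formal_Power_Series"
begin

text \<open>The scalar choice \<open>Q\<^sub>i\<^sub>j = q\<^sub>i\<^sub>j I\<close> on all of \<open>K\<close> works, so it suffices to dilate the
  contractions to unitaries with the same commutation phases. Dilate one operator \<open>T\<close> at a time by
  the Schaeffer matrix on \<open>l\<^sup>2(\<int>, V)\<close> and extend each other operator \<open>S\<close>, where \<open>T S = r S T\<close>, to the
  diagonal operator with entries \<open>r\<^sup>-\<^sup>n S\<close>. Because \<open>S\<close> also \<open>q\<close>-commutes with \<open>T\<^sup>*\<close>, it commutes
  with \<open>T\<^sup>* T\<close> and \<open>T T\<^sup>*\<close>, hence with the two defect operators, and so the extension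
  keeps the commutation phases. It also stays unitary if \<open>S\<close> was, so that finitely many
  steps make all operators unitary.\<close>

section \<open>Inner product spaces and adjoint pairs\<close>

text \<open>The weights of the diagonal extension come from the shift inside the Schaeffer matrix:
  an entry that moves one place to the right must pick up the factor \<open>r\<close>, whereas the
  defect operators commute with \<open>S\<close> without any phase. Two obstacles shape the
  induction. The relations with the adjoints of the other operators have to be carried along,
  because the next step again needs defect operators that commute with them. And compression is not
  multiplicative, so the dilation identity rests on the order of the factors: in a product where
  each index occurs at most once, the factors to the right of the dilated one preserve the embedded
  copy of the old space, and those to its left act coordinatewise, so that only coordinate 0 is
  seen, whatever the signs of the exponents. The defect operators need no spectral theory: the
  binomial series of sqrt (1 - t) is absolutely summable at t = 1, hence it converges weakly for
  every self-adjoint contraction, and the Riesz theorem turns the weak sum into an operator.\<close>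

lemma linear_coeff_zero:
  fixes a d :: real
  assumes nonneg: "\<And>t. 0 \<le> 2 * t * d + t\<^sup>2 * a"
  shows "d = 0"
proof -
  let ?N = "\<bar>a\<bar> + 1"
  \<comment> \<open>Taking t = - d / N with N above the modulus of \<open>a\<close> lets the linear
    term win: the bracket becomes a negative multiple of the square of \<open>d\<close>.\<close>
  have "0 \<le> ?N\<^sup>2 * (2 * (- d / ?N) * d + (- d / ?N)\<^sup>2 * a)"
    by (rule mult_nonneg_nonneg[OF zero_le_power2 nonneg])
  also have "\<dots> = d\<^sup>2 * (a - 2 * ?N)"
    by (simp add: power2_eq_square divide_simps) (simp add: algebra_simps)
  finally show ?thesis by (simp add: zero_le_mult_iff abs_if split: if_splits)
qed

lemma unit_cnj: "cmod a = 1 \<Longrightarrow> a * cnj a = 1"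
  by (metis complex_norm_square of_real_1 power_one)

text \<open>\<open>eq_if_dist_zero\<close> makes the inner product separate points of the carrier, so every
  vector space identity is checked against the inner product; unlike the vector space axioms,
  these assumptions pass directly to \<open>perp_space\<close>.\<close>
locale inner_space =
  fixes V :: "'a hspace"
  assumes zero_in [simp]: "hzero V \<in> hcarrier V"
    and add_in [simp]: "x \<in> hcarrier V \<Longrightarrow> y \<in> hcarrier V \<Longrightarrow> hadd V x y \<in> hcarrier V"
    and scale_in [simp]: "x \<in> hcarrier V \<Longrightarrow> hscale V c x \<in> hcarrier V"
    and inner_zero_left [simp]: "x \<in> hcarrier V \<Longrightarrow> hinner V (hzero V) x = 0"
    and inner_add_left [simp]: "x \<in> hcarrier V \<Longrightarrow> y \<in> hcarrier V \<Longrightarrow> z \<in> hcarrier V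
      \<Longrightarrow> hinner V (hadd V x y) z = hinner V x z + hinner V y z"
    and inner_scale_left [simp]: "x \<in> hcarrier V \<Longrightarrow> y \<in> hcarrier V
      \<Longrightarrow> hinner V (hscale V c x) y = c * hinner V x y"
    and inner_sym: "x \<in> hcarrier V \<Longrightarrow> y \<in> hcarrier V \<Longrightarrow> hinner V x y = cnj (hinner V y x)"
    and inner_nonneg: "x \<in> hcarrier V \<Longrightarrow> 0 \<le> Re (hinner V x x)"
    and eq_if_dist_zero: "x \<in> hcarrier V \<Longrightarrow> y \<in> hcarrier V
      \<Longrightarrow> hinner V (hminus V x y) (hminus V x y) = 0 \<Longrightarrow> x = y"
begin

lemma minus_in [simp]: "x \<in> hcarrier V \<Longrightarrow> y \<in> hcarrier V \<Longrightarrow> hminus V x y \<in> hcarrier V"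
  by (simp add: hminus_def)

lemma inner_minus_left [simp]: "x \<in> hcarrier V \<Longrightarrow> y \<in> hcarrier V \<Longrightarrow> z \<in> hcarrier V
      \<Longrightarrow> hinner V (hminus V x y) z = hinner V x z - hinner V y z"
  by (simp add: hminus_def)

lemma inner_zero_right [simp]: "x \<in> hcarrier V \<Longrightarrow> hinner V x (hzero V) = 0"
  by (subst inner_sym) auto

lemma inner_add_right [simp]: "x \<in> hcarrier V \<Longrightarrow> y \<in> hcarrier V \<Longrightarrow> z \<in> hcarrier V
      \<Longrightarrow> hinner V z (hadd V x y) = hinner V z x + hinner V z y"
  by (subst (1 2 3) inner_sym) auto

lemma inner_scale_right [simp]: "x \<in> hcarrier V \<Longrightarrow> y \<in> hcarrier V
      \<Longrightarrow> hinner V y (hscale V c x) = cnj c * hinner V y x"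
  by (subst (1 2) inner_sym) auto

lemma inner_minus_right [simp]: "x \<in> hcarrier V \<Longrightarrow> y \<in> hcarrier V \<Longrightarrow> z \<in> hcarrier V
      \<Longrightarrow> hinner V z (hminus V x y) = hinner V z x - hinner V z y"
  by (simp add: hminus_def)

lemma inner_eqI:
  assumes "x \<in> hcarrier V" "y \<in> hcarrier V"
    and "\<And>z. z \<in> hcarrier V \<Longrightarrow> hinner V x z = hinner V y z"
  shows "x = y"
  by (rule eq_if_dist_zero) (use assms in auto)

lemma inner_eqI':
  assumes "x \<in> hcarrier V" "y \<in> hcarrier V"
    and "\<And>z. z \<in> hcarrier V \<Longrightarrow> hinner V z x = hinner V z y"
  shows "x = y"
  by (rule inner_eqI) (use assms inner_sym in metis)+

lemma inner_self: "x \<in> hcarrier V \<Longrightarrow> hinner V x x = of_real (Re (hinner V x x))"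
  using inner_sym[of x x] by (simp add: complex_eq_iff)

lemma hnorm_nonneg [simp]: "x \<in> hcarrier V \<Longrightarrow> 0 \<le> hnorm V x"
  by (simp add: hnorm_def inner_nonneg)

lemma hnorm_sq: "x \<in> hcarrier V \<Longrightarrow> (hnorm V x)\<^sup>2 = Re (hinner V x x)"
  by (simp add: hnorm_def inner_nonneg)

lemma inner_self_hnorm: "x \<in> hcarrier V \<Longrightarrow> hinner V x x = of_real ((hnorm V x)\<^sup>2)"
  by (metis hnorm_sq inner_self)

lemma hnorm_scale: "x \<in> hcarrier V \<Longrightarrow> hnorm V (hscale V c x) = cmod c * hnorm V x"
proof -
  assume x: "x \<in> hcarrier V"
  have "hinner V (hscale V c x) (hscale V c x) = (c * cnj c) * hinner V x x"
    using x by simp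
  also have "\<dots> = of_real ((cmod c)\<^sup>2) * of_real ((hnorm V x)\<^sup>2)"
    by (simp only: complex_norm_square inner_self_hnorm[OF x])
  also have "\<dots> = of_real ((cmod c * hnorm V x)\<^sup>2)" by (simp add: power_mult_distrib)
  finally have "hnorm V (hscale V c x) = sqrt ((cmod c * hnorm V x)\<^sup>2)"
    by (simp only: hnorm_def[of V "hscale V c x"] Re_complex_of_real)
  then show ?thesis using x by simp
qed

lemma cauchy_schwarz:
  assumes x: "x \<in> hcarrier V" and y: "y \<in> hcarrier V"
  shows "cmod (hinner V x y) \<le> hnorm V x * hnorm V y"
proof (cases "hnorm V y = 0")
  case True
  then have "hinner V y y = 0" using inner_self_hnorm[OF y] by simp
  then have "y = hzero V" using y by (intro eq_if_dist_zero) auto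
  then show ?thesis using x by (simp add: True)
next
  case False
  let ?N = "(hnorm V y)\<^sup>2" and ?a = "hinner V x y"
  have N: "?N > 0" using False by simp
  \<comment> \<open>\<open>c\<close> is the coefficient of the orthogonal projection of
    \<open>x\<close> onto the line through \<open>y\<close>, so \<open>?w\<close> below is the
    orthogonal remainder.\<close>
  define c where "c = ?a / of_real ?N"
  have ca: "c * cnj ?a = of_real ((cmod ?a)\<^sup>2 / ?N)"
    unfolding c_def by (metis complex_norm_square of_real_divide times_divide_eq_left)
  have caN: "c * of_real ?N = ?a" using N by (simp add: c_def)
  let ?w = "hminus V x (hscale V c y)"
  have "hinner V ?w ?w = hinner V x x - c * hinner V y x - cnj c * (?a - c * hinner V y y)"
    using x y by (simp add: algebra_simps)
  also have "\<dots> = hinner V x x - c * cnj ?a"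
    using caN by (simp add: inner_self_hnorm[OF y] inner_sym[OF y x] )
  also have "\<dots> = of_real ((hnorm V x)\<^sup>2 - (cmod ?a)\<^sup>2 / ?N)"
    by (simp add: ca inner_self_hnorm[OF x])
  finally have "0 \<le> (hnorm V x)\<^sup>2 - (cmod ?a)\<^sup>2 / ?N"
    using inner_nonneg[of ?w] x y by (metis Re_complex_of_real minus_in scale_in)
  then have "(cmod ?a)\<^sup>2 \<le> (hnorm V x * hnorm V y)\<^sup>2"
    using N by (simp add: pos_divide_le_eq power_mult_distrib)
  then show ?thesis by (rule power2_le_imp_le) (use x y in simp)
qed

lemma hnorm_add_le:
  assumes x: "x \<in> hcarrier V" and y: "y \<in> hcarrier V"
  shows "hnorm V (hadd V x y) \<le> hnorm V x + hnorm V y"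
proof (rule power2_le_imp_le)
  have "Re (hinner V y x) = Re (hinner V x y)" by (subst inner_sym[OF y x]) simp
  then have "(hnorm V (hadd V x y))\<^sup>2 = (hnorm V x)\<^sup>2 + 2 * Re (hinner V x y) + (hnorm V y)\<^sup>2"
    using x y by (simp add: hnorm_sq)
  also have "\<dots> \<le> (hnorm V x)\<^sup>2 + 2 * (hnorm V x * hnorm V y) + (hnorm V y)\<^sup>2"
    using cauchy_schwarz[OF x y] complex_Re_le_cmod[of "hinner V x y"] by linarith
  finally show "(hnorm V (hadd V x y))\<^sup>2 \<le> (hnorm V x + hnorm V y)\<^sup>2"
    by (simp add: power2_sum)
qed (use x y in auto)

lemma hnorm_minus_commute:
  assumes x: "x \<in> hcarrier V" and y: "y \<in> hcarrier V"
  shows "hnorm V (hminus V x y) = hnorm V (hminus V y x)"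
  using x y by (simp add: hnorm_def)

lemma hnorm_dist_le:
  assumes x: "x \<in> hcarrier V" and y: "y \<in> hcarrier V" and z: "z \<in> hcarrier V"
  shows "hnorm V (hminus V x z) \<le> hnorm V (hminus V x y) + hnorm V (hminus V y z)"
proof -
  have "hminus V x z = hadd V (hminus V x y) (hminus V y z)"
    by (rule inner_eqI) (use x y z in auto)
  then show ?thesis using hnorm_add_le[of "hminus V x y" "hminus V y z"] x y z by simp
qed

text \<open>The triangle inequality in squared form, as comparison tests need it: sums and
  differences of square summable sequences stay square summable.\<close>

lemma hnorm_add_sq_le:
  assumes x: "x \<in> hcarrier V" and y: "y \<in> hcarrier V"
  shows "(hnorm V (hadd V x y))\<^sup>2 \<le> 2 * (hnorm V x)\<^sup>2 + 2 * (hnorm V y)\<^sup>2"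
proof -
  have "(hnorm V (hadd V x y))\<^sup>2 \<le> (hnorm V x + hnorm V y)\<^sup>2"
    using hnorm_add_le[OF x y] x y by (intro power_mono) auto
  also have "\<dots> \<le> 2 * (hnorm V x)\<^sup>2 + 2 * (hnorm V y)\<^sup>2"
    using sum_squares_ge_zero[of "hnorm V x - hnorm V y" 0] by (simp add: power2_eq_square algebra_simps)
  finally show ?thesis .
qed

lemma scale_scale: "x \<in> hcarrier V \<Longrightarrow> hscale V a (hscale V b x) = hscale V (a * b) x"
  by (rule inner_eqI) auto

lemma scale_one: "x \<in> hcarrier V \<Longrightarrow> hscale V 1 x = x"
  by (rule inner_eqI) auto

lemma zero_add: "x \<in> hcarrier V \<Longrightarrow> hadd V (hzero V) x = x"
  and add_zero: "x \<in> hcarrier V \<Longrightarrow> hadd V x (hzero V) = x"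
  by (rule inner_eqI; simp)+

lemma scale_zero: "hscale V a (hzero V) = hzero V"
  by (rule inner_eqI) auto

text \<open>\<open>hproj\<close> is a choice, so uniqueness is the point: the difference of two
  candidates lies in \<open>S\<close> and is orthogonal to \<open>S\<close>, hence to
  itself.\<close>

lemma hproj_eqI:
  assumes S: "S \<subseteq> hcarrier V" "\<And>x y. x \<in> S \<Longrightarrow> y \<in> S \<Longrightarrow> hminus V x y \<in> S"
    and z: "z \<in> hcarrier V" and p: "p \<in> S"
    and orth: "\<And>s. s \<in> S \<Longrightarrow> hinner V z s = hinner V p s"
  shows "hproj V S z = p"
  unfolding hproj_def
proof (rule some_equality)
  show "p \<in> S \<and> (\<forall>s\<in>S. hinner V (hminus V z p) s = 0)"
    using assms by (auto simp: subset_iff)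
  fix p' assume p': "p' \<in> S \<and> (\<forall>s\<in>S. hinner V (hminus V z p') s = 0)"
  have "hinner V p' s = hinner V p s" if "s \<in> S" for s
    using p' S(1) z orth that by (fastforce simp: subset_iff)
  then show "p' = p"
    using S(2)[of p' p] p p' S(1) by (intro eq_if_dist_zero) (auto simp: subset_iff)
qed

end

lemma (in inner_space) hnorm_diff_tendsto:
  assumes "a \<in> hcarrier V" "l \<in> hcarrier V" "\<And>n. g n \<in> hcarrier V"
    and lim: "(\<lambda>n. hnorm V (hminus V (g n) l)) \<longlonglongrightarrow> 0"
  shows "(\<lambda>n. hnorm V (hminus V a (g n))) \<longlonglongrightarrow> hnorm V (hminus V a l)"
proof (rule LIM_zero_cancel, rule tendsto_0_le[OF lim])
  show "\<forall>\<^sub>F n in sequentially. norm (hnorm V (hminus V a (g n)) - hnorm V (hminus V a l))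
      \<le> norm (hnorm V (hminus V (g n) l)) * 1"
  proof (intro always_eventually allI)
    fix n
    show "norm (hnorm V (hminus V a (g n)) - hnorm V (hminus V a l)) \<le> norm (hnorm V (hminus V (g n) l)) * 1"
      using hnorm_dist_le[of a "g n" l] hnorm_dist_le[of a l "g n"] hnorm_minus_commute[of l "g n"] assms
      by simp
  qed
qed

text \<open>Linearity on the carrier is automatic for operators that have an adjoint.\<close>
definition adj_pair :: "'a hspace \<Rightarrow> ('a \<Rightarrow> 'a) \<Rightarrow> ('a \<Rightarrow> 'a) \<Rightarrow> bool" where
  "adj_pair V S S' \<longleftrightarrow> (\<forall>x\<in>hcarrier V. S x \<in> hcarrier V) \<and> (\<forall>x\<in>hcarrier V. S' x \<in> hcarrier V) \<and>
     (\<forall>x\<in>hcarrier V. \<forall>y\<in>hcarrier V. hinner V (S x) y = hinner V x (S' y))"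

text \<open>The adjoint is carried as a second operator, because \<open>hadj\<close> is a choice
  that yields nothing until some adjoint is exhibited; \<open>hadj_eq\<close> identifies the two on
  the carrier.\<close>

definition contr_pair :: "'a hspace \<Rightarrow> ('a \<Rightarrow> 'a) \<Rightarrow> ('a \<Rightarrow> 'a) \<Rightarrow> bool" where
  "contr_pair V S S' \<longleftrightarrow> adj_pair V S S' \<and> (\<forall>x\<in>hcarrier V. hnorm V (S x) \<le> hnorm V x)"

definition unitary_pair :: "'a hspace \<Rightarrow> ('a \<Rightarrow> 'a) \<Rightarrow> ('a \<Rightarrow> 'a) \<Rightarrow> bool" where
  "unitary_pair V S S' \<longleftrightarrow> adj_pair V S S' \<and> (\<forall>x\<in>hcarrier V. S (S' x) = x \<and> S' (S x) = x)"

lemma adj_pair_in: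
  "adj_pair V S S' \<Longrightarrow> x \<in> hcarrier V \<Longrightarrow> S x \<in> hcarrier V"
  "adj_pair V S S' \<Longrightarrow> x \<in> hcarrier V \<Longrightarrow> S' x \<in> hcarrier V"
  by (auto simp: adj_pair_def)

lemma adj_pair_inner:
  "adj_pair V S S' \<Longrightarrow> x \<in> hcarrier V \<Longrightarrow> y \<in> hcarrier V \<Longrightarrow> hinner V (S x) y = hinner V x (S' y)"
  by (auto simp: adj_pair_def)

context inner_space
begin

lemma adj_pair_sym: "adj_pair V S S' \<Longrightarrow> adj_pair V S' S"
  unfolding adj_pair_def by (metis inner_sym)

lemma adj_pair_add: "adj_pair V S S' \<Longrightarrow> x \<in> hcarrier V \<Longrightarrow> y \<in> hcarrier V
    \<Longrightarrow> S (hadd V x y) = hadd V (S x) (S y)"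
  by (rule inner_eqI) (auto simp: adj_pair_def)

lemma adj_pair_minus: "adj_pair V S S' \<Longrightarrow> x \<in> hcarrier V \<Longrightarrow> y \<in> hcarrier V
    \<Longrightarrow> S (hminus V x y) = hminus V (S x) (S y)"
  by (rule inner_eqI) (auto simp: adj_pair_def)

lemma adj_pair_scale: "adj_pair V S S' \<Longrightarrow> x \<in> hcarrier V
    \<Longrightarrow> S (hscale V c x) = hscale V c (S x)"
  by (rule inner_eqI) (auto simp: adj_pair_def)

lemma adj_pair_zero: "adj_pair V S S' \<Longrightarrow> S (hzero V) = hzero V"
  by (rule inner_eqI) (auto simp: adj_pair_def)

lemma adj_pair_unique: "adj_pair V S A \<Longrightarrow> adj_pair V S B \<Longrightarrow> x \<in> hcarrier V \<Longrightarrow> A x = B x"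
  by (rule inner_eqI') (auto simp: adj_pair_def)

text \<open>Cauchy-Schwarz applied to \<open>hinner V (S (S' x)) x\<close>, which is the squared
  norm of \<open>S' x\<close>, after which one factor \<open>hnorm V (S' x)\<close> cancels. If that
  factor is zero, the bound at \<open>x\<close> itself shows that the right-hand side is
  nonnegative.\<close>

lemma adj_pair_bound_sym:
  assumes "adj_pair V S S'" "\<And>x. x \<in> hcarrier V \<Longrightarrow> hnorm V (S x) \<le> B * hnorm V x" "x \<in> hcarrier V"
  shows "hnorm V (S' x) \<le> B * hnorm V x"
proof (cases "hnorm V (S' x) = 0")
  case True
  have "0 \<le> B * hnorm V x" using assms(2)[OF assms(3)] hnorm_nonneg adj_pair_in(1)[OF assms(1,3)] by (metis order_trans)
  then show ?thesis using True by simp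
next
  case False
  note in' = adj_pair_in[OF assms(1)]
  let ?y = "S' x"
  have y: "?y \<in> hcarrier V" using assms in' by auto
  have "(hnorm V ?y)\<^sup>2 = Re (hinner V (S ?y) x)"
    using adj_pair_inner[OF assms(1) y assms(3)] by (simp add: hnorm_sq y)
  also have "\<dots> \<le> hnorm V (S ?y) * hnorm V x"
    using cauchy_schwarz[of "S ?y" x] complex_Re_le_cmod[of "hinner V (S ?y) x"] in' y assms(3) by fastforce
  also have "\<dots> \<le> (B * hnorm V ?y) * hnorm V x"
    using assms(2)[OF y] assms(3) by (intro mult_right_mono) auto
  finally have "hnorm V ?y * hnorm V ?y \<le> hnorm V ?y * (B * hnorm V x)"
    by (simp add: power2_eq_square mult_ac)
  moreover have "hnorm V ?y > 0" using False hnorm_nonneg[OF y] by linarith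
  ultimately show ?thesis by simp
qed

lemma contr_pair_sym: "contr_pair V S S' \<Longrightarrow> contr_pair V S' S"
  using adj_pair_bound_sym[of S S' 1] adj_pair_sym by (auto simp: contr_pair_def)

lemma contr_pair_bounded: "contr_pair V S S' \<Longrightarrow> bounded_op V S"
  by (auto simp: bounded_op_def contr_pair_def adj_pair_in(1) adj_pair_add adj_pair_scale intro!: exI[of _ 1])

lemma unitary_pair_contr: assumes "unitary_pair V S S'" shows "contr_pair V S S'"
proof -
  have "hnorm V (S x) = hnorm V x" if "x \<in> hcarrier V" for x
    using assms that adj_pair_inner[of V S S' x "S x"] adj_pair_in[of V S S']
    by (auto simp: hnorm_def unitary_pair_def)
  then show ?thesis using assms by (auto simp: contr_pair_def unitary_pair_def)
qed

text \<open>\<open>S'\<close> is bounded and so witnesses that the choice in \<open>hadj\<close> is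
  not vacuous; any two adjoints agree on the carrier.\<close>

lemma hadj_eq:
  assumes "contr_pair V S S'" "x \<in> hcarrier V"
  shows "hadj V S x = S' x"
proof -
  let ?P = "\<lambda>R. bounded_op V R \<and>
      (\<forall>x\<in>hcarrier V. \<forall>y\<in>hcarrier V. hinner V (S x) y = hinner V x (R y))"
  have "?P S'" using assms contr_pair_bounded[OF contr_pair_sym[OF assms(1)]]
    by (auto simp: contr_pair_def adj_pair_def)
  then have "?P (hadj V S)" unfolding hadj_def by (rule someI[of ?P])
  then have "adj_pair V S (hadj V S)" using assms
    by (auto simp: adj_pair_def contr_pair_def bounded_op_def)
  then show ?thesis using assms adj_pair_unique by (auto simp: contr_pair_def)
qed

lemma unitary_pair_unitary: assumes "unitary_pair V S S'" shows "unitary V S"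
proof -
  note c = unitary_pair_contr[OF assms]
  have "S x \<in> hcarrier V" if "x \<in> hcarrier V" for x
    using c that by (auto simp: contr_pair_def adj_pair_in)
  then show ?thesis
    using assms contr_pair_bounded[OF c] by (auto simp: unitary_def hadj_eq[OF c] unitary_pair_def)
qed

lemma scalar_unitary_pair:
  assumes "cmod c = 1" shows "unitary_pair V (hscale V c) (hscale V (cnj c))"
proof -
  have "c * cnj c = 1" using assms by (rule unit_cnj)
  then show ?thesis
    by (auto simp: unitary_pair_def adj_pair_def scale_scale scale_one mult.commute)
qed

end

section \<open>Completeness, the Riesz theorem and existence of adjoints\<close>

locale hilbert = inner_space +
  assumes complete: "\<And>f :: nat \<Rightarrow> 'a. (\<And>n. f n \<in> hcarrier V) \<Longrightarrow>
      (\<forall>e>0. \<exists>N. \<forall>m\<ge>N. \<forall>n\<ge>N. hnorm V (hminus V (f m) (f n)) < e)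
      \<Longrightarrow> \<exists>l\<in>hcarrier V. (\<lambda>n. hnorm V (hminus V (f n) l)) \<longlonglongrightarrow> 0"

text \<open>The axioms supply additive inverses merely as existing elements, while
  \<open>hminus\<close> scales by -1. Definiteness links the two: the inner product of
  \<open>hadd V y (hscale V (-1) y)\<close> with itself expands to 0. Cancellation then gives
  separation by distances.\<close>

lemma hilbert_space_imp_hilbert:
  assumes H: "hilbert_space V" shows "hilbert V"
proof -
  note H = H[unfolded hilbert_space_def Let_def]
  from H have z: "hzero V \<in> hcarrier V" by (elim conjE)
  from H have add: "\<forall>x\<in>hcarrier V. \<forall>y\<in>hcarrier V. hadd V x y \<in> hcarrier V" by (elim conjE)
  from H have sc: "\<forall>c. \<forall>x\<in>hcarrier V. hscale V c x \<in> hcarrier V" by (elim conjE)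
  from H have assoc: "\<forall>x\<in>hcarrier V. \<forall>y\<in>hcarrier V. \<forall>z\<in>hcarrier V. hadd V (hadd V x y) z = hadd V x (hadd V y z)"
    by (elim conjE)
  from H have comm: "\<forall>x\<in>hcarrier V. \<forall>y\<in>hcarrier V. hadd V x y = hadd V y x" by (elim conjE)
  from H have za: "\<forall>x\<in>hcarrier V. hadd V (hzero V) x = x" by (elim conjE)
  from H have neg: "\<forall>x\<in>hcarrier V. \<exists>y\<in>hcarrier V. hadd V x y = hzero V" by (elim conjE)
  from H have il: "\<forall>x\<in>hcarrier V. \<forall>y\<in>hcarrier V. \<forall>z\<in>hcarrier V. hinner V (hadd V x y) z = hinner V x z + hinner V y z"
    by (elim conjE)
  from H have isc: "\<forall>c. \<forall>x\<in>hcarrier V. \<forall>y\<in>hcarrier V. hinner V (hscale V c x) y = c * hinner V x y" by (elim conjE)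
  from H have sym: "\<forall>x\<in>hcarrier V. \<forall>y\<in>hcarrier V. hinner V x y = cnj (hinner V y x)" by (elim conjE)
  from H have pos: "\<forall>x\<in>hcarrier V. 0 \<le> Re (hinner V x x)" by (elim conjE)
  from H have def: "\<forall>x\<in>hcarrier V. hinner V x x = 0 \<longrightarrow> x = hzero V" by (elim conjE)
  from H have compl: "\<forall>f :: nat \<Rightarrow> 'a. (\<forall>n. f n \<in> hcarrier V) \<and>
          (\<forall>e>0. \<exists>N. \<forall>m\<ge>N. \<forall>n\<ge>N. hnorm V (hminus V (f m) (f n)) < e)
          \<longrightarrow> (\<exists>l\<in>hcarrier V. (\<lambda>n. hnorm V (hminus V (f n) l)) \<longlonglongrightarrow> 0)" by (elim conjE)
  have cancel: "x = y" if x: "x \<in> hcarrier V" and y: "y \<in> hcarrier V" and w: "w \<in> hcarrier V"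
    and eq: "hadd V x w = hadd V y w" for x y w
  proof -
    obtain w' where w': "w' \<in> hcarrier V" "hadd V w w' = hzero V" using bspec[OF neg w] by auto
    have "hadd V (hzero V) u = hadd V (hadd V u w) w'" if u: "u \<in> hcarrier V" for u
      using assoc[rule_format, OF u w w'(1)] comm[rule_format, OF u z] w'(2) by simp
    then show ?thesis using x y eq za by metis
  qed
  have neg1: "hadd V y (hscale V (-1) y) = hzero V" if y: "y \<in> hcarrier V" for y
  proof -
    have "hinner V (hadd V y (hscale V (-1) y)) (hadd V y (hscale V (-1) y)) = 0"
      using y sc add il isc by simp
    then show ?thesis using def add sc y by simp
  qed
  show ?thesis
  proof
    show "hinner V (hzero V) x = 0" if "x \<in> hcarrier V" for x
      using il[rule_format, OF z z that] za z by simp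
    show "x = y" if "x \<in> hcarrier V" "y \<in> hcarrier V"
      "hinner V (hminus V x y) (hminus V x y) = 0" for x y
    proof (rule cancel)
      have "hadd V x (hscale V (-1) y) = hzero V"
        using def that add sc by (simp add: hminus_def)
      then show "hadd V x (hscale V (-1) y) = hadd V y (hscale V (-1) y)"
        using neg1 that by simp
    qed (use that sc in auto)
    show "\<exists>l\<in>hcarrier V. (\<lambda>n. hnorm V (hminus V (f n) l)) \<longlonglongrightarrow> 0"
      if "\<And>n. f n \<in> hcarrier V" "\<forall>e>0. \<exists>N. \<forall>m\<ge>N. \<forall>n\<ge>N. hnorm V (hminus V (f m) (f n)) < e" for f :: "nat \<Rightarrow> 'a"
      using that by (intro compl[rule_format]) simp
    show "hinner V x y = cnj (hinner V y x)" if "x \<in> hcarrier V" "y \<in> hcarrier V" for x y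
      by (rule sym[rule_format, OF that])
  qed (simp_all add: z add sc il isc pos)
qed

lemma (in hilbert) hilbert_space: "hilbert_space V"
  unfolding hilbert_space_def Let_def
proof (intro conjI ballI allI impI)
  show "\<exists>y\<in>hcarrier V. hadd V x y = hzero V" if "x \<in> hcarrier V" for x
    by (rule bexI[of _ "hscale V (-1) x"], rule inner_eqI) (use that in auto)
  show "hinner V x x = 0 \<Longrightarrow> x = hzero V" if "x \<in> hcarrier V" for x
    by (rule eq_if_dist_zero) (use that in auto)
  show "\<exists>l\<in>hcarrier V. (\<lambda>n. hnorm V (hminus V (f n) l)) \<longlonglongrightarrow> 0"
    if "(\<forall>n. f n \<in> hcarrier V) \<and> (\<forall>e>0. \<exists>N. \<forall>m\<ge>N. \<forall>n\<ge>N. hnorm V (hminus V (f m) (f n)) < e)" for f :: "nat \<Rightarrow> 'a"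
    using complete that by blast
  show "hinner V x y = cnj (hinner V y x)" if "x \<in> hcarrier V" "y \<in> hcarrier V" for x y
    using inner_sym that .
qed (simp_all add: inner_nonneg, (rule inner_eqI; simp add: algebra_simps)+)

context hilbert
begin

text \<open>The representing vector minimises \<open>(hnorm V x)\<^sup>2 - 2 * Re (f x)\<close>.\<close>
lemma riesz:
  assumes add: "\<And>x y. x \<in> hcarrier V \<Longrightarrow> y \<in> hcarrier V \<Longrightarrow> f (hadd V x y) = f x + f y"
    and scale: "\<And>c x. x \<in> hcarrier V \<Longrightarrow> f (hscale V c x) = c * f x"
    and bound: "\<And>x. x \<in> hcarrier V \<Longrightarrow> cmod (f x) \<le> B * hnorm V x"
  shows "\<exists>y\<in>hcarrier V. \<forall>x\<in>hcarrier V. f x = hinner V x y"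
proof -
  define \<Phi> where "\<Phi> x = (hnorm V x)\<^sup>2 - 2 * Re (f x)" for x
  define \<mu> where "\<mu> = Inf (\<Phi> ` hcarrier V)"
  have below: "- (B\<^sup>2) \<le> \<Phi> x" if "x \<in> hcarrier V" for x
  proof -
    have "Re (f x) \<le> B * hnorm V x" using bound[OF that] complex_Re_le_cmod order_trans by blast
    moreover have "0 \<le> (hnorm V x - B)\<^sup>2" by simp
    ultimately show ?thesis by (simp add: \<Phi>_def power2_diff algebra_simps)
  qed
  have bdd: "bdd_below (\<Phi> ` hcarrier V)" using below by (auto intro!: bdd_belowI2)
  have le: "\<mu> \<le> \<Phi> x" if "x \<in> hcarrier V" for x
    unfolding \<mu>_def using bdd that by (auto intro: cInf_lower)
  have "\<exists>x\<in>hcarrier V. \<Phi> x < \<mu> + inverse (real (Suc n))" for n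
  proof -
    have "Inf (\<Phi> ` hcarrier V) < \<mu> + inverse (real (Suc n))" unfolding \<mu>_def by simp
    then show ?thesis using bdd zero_in cInf_less_iff[of "\<Phi> ` hcarrier V" "\<mu> + inverse (real (Suc n))"] by blast
  qed
  then obtain g where g: "\<And>n. g n \<in> hcarrier V" "\<And>n. \<Phi> (g n) < \<mu> + inverse (real (Suc n))" by metis
  \<comment> \<open>The parallelogram law, in which the linear terms cancel by additivity of
    \<open>f\<close>. Since the midpoint has value at least \<open>\<mu>\<close>, minimising
    sequences are Cauchy.\<close>
  have par: "(hnorm V (hminus V x y))\<^sup>2 = 2 * \<Phi> x + 2 * \<Phi> y - 4 * \<Phi> (hscale V (1/2) (hadd V x y))"
    if "x \<in> hcarrier V" "y \<in> hcarrier V" for x y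
    using that by (simp add: \<Phi>_def hnorm_sq add scale algebra_simps)
  have "\<exists>N. \<forall>m\<ge>N. \<forall>n\<ge>N. hnorm V (hminus V (g m) (g n)) < e" if e: "e > 0" for e
  proof -
    \<comment> \<open>By \<open>par\<close> the squared distance is at most four times
      \<open>inverse (real (Suc N))\<close>.\<close>
    obtain N where N: "inverse (real (Suc N)) < e\<^sup>2 / 4"
      using reals_Archimedean[of "e\<^sup>2 / 4"] e by auto
    have "hnorm V (hminus V (g m) (g n)) < e" if mn: "m \<ge> N" "n \<ge> N" for m n
    proof (rule power2_less_imp_less)
      have "inverse (real (Suc m)) \<le> inverse (real (Suc N))" "inverse (real (Suc n)) \<le> inverse (real (Suc N))"
        using mn by (auto intro!: le_imp_inverse_le)
      then show "(hnorm V (hminus V (g m) (g n)))\<^sup>2 < e\<^sup>2"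
        using par[OF g(1) g(1), of m n] g(2)[of m] g(2)[of n] N
          le[OF scale_in[OF add_in[OF g(1) g(1)]], of "1/2" m n] by linarith
    qed (use e in auto)
    then show ?thesis by blast
  qed
  then obtain l where l: "l \<in> hcarrier V" "(\<lambda>n. hnorm V (hminus V (g n) l)) \<longlonglongrightarrow> 0"
    using complete[of g] g(1) by blast
  have lim: "(\<lambda>n. hinner V (g n) v) \<longlonglongrightarrow> hinner V l v" if v: "v \<in> hcarrier V" for v
  proof (rule LIM_zero_cancel, rule tendsto_0_le[OF l(2)])
    show "\<forall>\<^sub>F n in sequentially. norm (hinner V (g n) v - hinner V l v)
        \<le> norm (hnorm V (hminus V (g n) l)) * hnorm V v"
      using cauchy_schwarz[of "hminus V (g _) l" v] g l v by (intro always_eventually) auto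
  qed
  \<comment> \<open>Minimality is tested at \<open>g n\<close>, up to the error
    \<open>inverse (real (Suc n))\<close>, and the limit is taken afterwards; convergence of
    \<open>hinner V (g n) v\<close> is then enough.\<close>
  have var: "0 \<le> 2 * t * (Re (hinner V l v) - Re (f v)) + t\<^sup>2 * (hnorm V v)\<^sup>2"
    if v: "v \<in> hcarrier V" for v and t :: real
  proof -
    have "- inverse (real (Suc n)) \<le> 2 * t * (Re (hinner V (g n) v) - Re (f v)) + t\<^sup>2 * (hnorm V v)\<^sup>2" for n
    proof -
      have "Re (hinner V v (g n)) = Re (hinner V (g n) v)" by (subst inner_sym) (use v g in auto)
      then have "\<Phi> (hadd V (g n) (hscale V t v)) = \<Phi> (g n) + 2 * t * (Re (hinner V (g n) v) - Re (f v)) + t\<^sup>2 * (hnorm V v)\<^sup>2"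
        using v g by (simp add: \<Phi>_def hnorm_sq add scale algebra_simps power2_eq_square[of t])
      then show ?thesis using le[of "hadd V (g n) (hscale V t v)"] g[of n] v by auto
    qed
    moreover have "(\<lambda>n. - inverse (real (Suc n))) \<longlonglongrightarrow> - 0"
      by (intro tendsto_minus LIMSEQ_inverse_real_of_nat)
    moreover have "(\<lambda>n. 2 * t * (Re (hinner V (g n) v) - Re (f v)) + t\<^sup>2 * (hnorm V v)\<^sup>2) \<longlonglongrightarrow>
       2 * t * (Re (hinner V l v) - Re (f v)) + t\<^sup>2 * (hnorm V v)\<^sup>2"
      by (intro tendsto_intros lim v)
    ultimately show ?thesis using LIMSEQ_le by fastforce
  qed
  have re: "Re (hinner V l v) = Re (f v)" if v: "v \<in> hcarrier V" for v
    using linear_coeff_zero[OF var[OF v]] by simp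
  have "f v = hinner V v l" if v: "v \<in> hcarrier V" for v
  proof -
    \<comment> \<open>The variation determines real parts; multiplying the vector by
      \<open>\<i>\<close> turns the imaginary part into one.\<close>
    have "Re (hinner V l (hscale V \<i> v)) = Re (f (hscale V \<i> v))" by (rule re) (use v in simp)
    then have "Im (hinner V l v) = - Im (f v)" using v l by (simp add: scale)
    then show ?thesis using re[OF v] by (subst inner_sym) (use v l in \<open>auto simp: complex_eq_iff\<close>)
  qed
  then show ?thesis using l by blast
qed

text \<open>For each \<open>y\<close> the Riesz theorem represents the functional sending
  \<open>x\<close> to \<open>hinner V (S x) y\<close>. The representing vectors form an adjoint,
  with which \<open>hadj\<close> then agrees.\<close>

lemma contraction_contr_pair:
  assumes "contraction V S" shows "contr_pair V S (hadj V S)"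
proof -
  have b: "bounded_op V S" and c: "\<And>x. x \<in> hcarrier V \<Longrightarrow> hnorm V (S x) \<le> hnorm V x"
    using assms by (auto simp: contraction_def)
  have Sin: "\<And>x. x \<in> hcarrier V \<Longrightarrow> S x \<in> hcarrier V" using b by (auto simp: bounded_op_def)
  have "\<exists>z\<in>hcarrier V. \<forall>x\<in>hcarrier V. hinner V (S x) y = hinner V x z" if y: "y \<in> hcarrier V" for y
  proof (rule riesz[where B = "hnorm V y"])
    fix x assume x: "x \<in> hcarrier V"
    have "cmod (hinner V (S x) y) \<le> hnorm V (S x) * hnorm V y" using cauchy_schwarz Sin x y by blast
    also have "\<dots> \<le> hnorm V y * hnorm V x"
      using mult_right_mono[OF c[OF x] hnorm_nonneg[OF y]] by (simp add: mult.commute)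
    finally show "cmod (hinner V (S x) y) \<le> hnorm V y * hnorm V x" .
  qed (use b y Sin in \<open>auto simp: bounded_op_def\<close>)
  then obtain S' where "\<And>y. y \<in> hcarrier V \<Longrightarrow> S' y \<in> hcarrier V"
    "\<And>x y. x \<in> hcarrier V \<Longrightarrow> y \<in> hcarrier V \<Longrightarrow> hinner V (S x) y = hinner V x (S' y)" by metis
  then have cp: "contr_pair V S S'" using Sin c by (auto simp: contr_pair_def adj_pair_def)
  then show ?thesis using hadj_eq[OF cp]
    by (auto simp: contr_pair_def adj_pair_def)
qed

end

section \<open>Defect operators\<close>

definition sqrt_coeff :: "nat \<Rightarrow> real" where
  "sqrt_coeff n = (-1) ^ n * ((1/2) gchoose n)"

lemma gbinomial_Suc_rec:
  "(a::'a::field_char_0) gchoose Suc n = (a gchoose n) * (a - of_nat n) / of_nat (Suc n)"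
  by (simp add: gbinomial_prod_rev divide_simps del: of_nat_Suc)

text \<open>From index 1 on, consecutive coefficients have a positive ratio and the first is -1/2.
  With a single sign after the constant term, a bound on partial sums becomes a bound on absolute
  sums.\<close>

lemma sqrt_coeff_Suc_nonpos: "sqrt_coeff (Suc n) \<le> 0"
proof (induction n)
  case (Suc n)
  have "sqrt_coeff (Suc (Suc n)) = sqrt_coeff (Suc n) * ((real (Suc n) - 1/2) / real (Suc (Suc n)))"
    unfolding sqrt_coeff_def by (subst gbinomial_Suc_rec) (simp add: divide_simps, simp add: algebra_simps)
  also have "\<dots> \<le> 0" using Suc by (intro mult_nonpos_nonneg) auto
  finally show ?case .
qed (simp add: sqrt_coeff_def)

text \<open>The alternating partial sums of the binomials of 1/2 telescope to a single signed
  binomial of -1/2, whose sign the same ratio argument controls.\<close>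

lemma sum_sqrt_coeff_nonneg: "0 \<le> (\<Sum>n\<le>N. sqrt_coeff n)"
proof -
  have pos: "0 \<le> (-1) ^ n * ((-1/2 :: real) gchoose n)" for n
  proof (induction n)
    case (Suc n)
    have "(-1) ^ Suc n * ((-1/2 :: real) gchoose Suc n)
        = ((-1) ^ n * ((-1/2) gchoose n)) * ((real n + 1/2) / real (Suc n))"
      by (subst gbinomial_Suc_rec) (simp add: divide_simps, simp add: algebra_simps)
    also have "\<dots> \<ge> 0" by (rule mult_nonneg_nonneg[OF Suc]) simp
    finally show ?case .
  qed simp
  have "(\<Sum>n\<le>N. sqrt_coeff n) = (-1) ^ N * ((1/2 - 1) gchoose N)"
    using gbinomial_sum_lower_neg[of "1/2 :: real" N] by (simp add: sqrt_coeff_def mult.commute)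
  then show ?thesis using pos[of N] by simp
qed

text \<open>The absolute partial sum up to \<open>N\<close> is 2 minus the signed one. A contraction
  may have norm one, out of reach of a geometric bound, so summability at t = 1 is what the operator
  series requires.\<close>

lemma summable_abs_sqrt_coeff: "summable (\<lambda>n. \<bar>sqrt_coeff n\<bar>)"
proof (rule summableI_nonneg_bounded)
  fix N
  have "(\<Sum>n<N. \<bar>sqrt_coeff n\<bar>) \<le> (\<Sum>n\<le>N. \<bar>sqrt_coeff n\<bar>)" by (rule sum_mono2) auto
  also have "\<dots> = 1 - (\<Sum>n<N. sqrt_coeff (Suc n))"
    by (simp add: sum.atMost_shift abs_of_nonpos[OF sqrt_coeff_Suc_nonpos] sum_negf)
       (simp add: sqrt_coeff_def)
  also have "\<dots> \<le> 2"
    using sum_sqrt_coeff_nonneg[of N] by (simp add: sum.atMost_shift) (simp add: sqrt_coeff_def)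
  finally show "(\<Sum>n<N. \<bar>sqrt_coeff n\<bar>) \<le> 2" .
qed simp

text \<open>The square of the series is 1 - t: Vandermonde's identity with 1/2 + 1/2 = 1 leaves the
  binomials of 1.\<close>

lemma sqrt_coeff_convolution:
  "(\<Sum>i\<le>n. sqrt_coeff i * sqrt_coeff (n - i)) = (if n = 0 then 1 else if n = 1 then -1 else 0)"
proof -
  have "(\<Sum>i\<le>n. sqrt_coeff i * sqrt_coeff (n - i))
      = (-1) ^ n * (\<Sum>i\<le>n. ((1/2) gchoose i) * ((1/2) gchoose (n - i)))"
    unfolding sum_distrib_left
  proof (rule sum.cong)
    fix i assume "i \<in> {..n}"
    then have "(-1) ^ i * (-1) ^ (n - i) = ((-1) ^ n :: real)" by (simp flip: power_add)
    then show "sqrt_coeff i * sqrt_coeff (n - i) = (-1) ^ n * (((1/2) gchoose i) * ((1/2) gchoose (n - i)))"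
      by (metis (no_types, lifting) mult.assoc mult.left_commute sqrt_coeff_def)
  qed simp
  also have "\<dots> = (-1) ^ n * (of_nat 1 gchoose n)"
    using gbinomial_Vandermonde[of "1/2 :: real" "1/2" n] by (simp add: atLeast0AtMost)
  also have "\<dots> = (if n = 0 then 1 else if n = 1 then -1 else 0)"
    by (simp only: binomial_gbinomial[symmetric]) (auto simp: binomial_eq_0)
  finally show ?thesis .
qed

lemma summable_mult_bounded:
  fixes g :: "nat \<Rightarrow> complex"
  assumes "summable (\<lambda>n. \<bar>c n\<bar>)" "\<And>n. cmod (g n) \<le> M"
  shows "summable (\<lambda>n. cmod (of_real (c n) * g n))"
proof (rule summable_comparison_test)
  show "summable (\<lambda>n. \<bar>c n\<bar> * M)" using assms(1) by (rule summable_mult2)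
qed (use assms(2) in \<open>auto simp: norm_mult intro!: mult_left_mono exI[of _ 0]\<close>)

text \<open>The factor \<open>g (n + m)\<close> keeps this from being a Cauchy product of two series.\<close>
lemma double_sum_antidiagonal:
  fixes g :: "nat \<Rightarrow> complex" and c :: "nat \<Rightarrow> real"
  assumes c: "summable (\<lambda>n. \<bar>c n\<bar>)" and g: "\<And>n. cmod (g n) \<le> M"
  shows "(\<Sum>n. of_real (c n) * (\<Sum>m. of_real (c m) * g (n + m)))
       = (\<Sum>k. of_real (\<Sum>i\<le>k. c i * c (k - i)) * g k)"
proof -
  define F where "F = (\<lambda>(n, m). complex_of_real (c n) * (of_real (c m) * g (n + m)))"
  have M: "0 \<le> M" using g[of 0] norm_ge_zero order_trans by blast
  have csum: "(\<lambda>n. \<bar>c n\<bar>) summable_on UNIV"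
    using c by (intro norm_summable_imp_summable_on) simp
  have "(\<lambda>(n, m). \<bar>c n\<bar> * \<bar>c m\<bar>) summable_on UNIV \<times> UNIV"
    using csum by (intro summable_on_SigmaI[where g = "\<lambda>n. \<bar>c n\<bar> * infsum (\<lambda>m. \<bar>c m\<bar>) UNIV"])
      (auto intro!: has_sum_cmult_right has_sum_infsum summable_on_cmult_left)
  then have "(\<lambda>p. (case p of (n, m) \<Rightarrow> \<bar>c n\<bar> * \<bar>c m\<bar>) * M) summable_on UNIV \<times> UNIV"
    by (rule summable_on_cmult_left)
  then have "F abs_summable_on UNIV \<times> UNIV"
    by (rule summable_on_comparison_test)
      (auto simp: F_def norm_mult mult.assoc intro!: mult_left_mono g)
  then have Fsum: "F summable_on UNIV \<times> UNIV" by (rule abs_summable_summable)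
  have inner: "summable (\<lambda>m. cmod (of_real (c m) * g (n + m)))" for n
    using c g by (rule summable_mult_bounded)
  have bnd: "cmod (\<Sum>m. of_real (c m) * g (n + m)) \<le> (\<Sum>m. \<bar>c m\<bar>) * M" for n
  proof -
    have "cmod (\<Sum>m. of_real (c m) * g (n + m)) \<le> (\<Sum>m. cmod (of_real (c m) * g (n + m)))"
      by (rule summable_norm[OF inner])
    also have "\<dots> \<le> (\<Sum>m. \<bar>c m\<bar> * M)"
      by (rule suminf_le[OF _ inner summable_mult2[OF c]]) (auto simp: norm_mult intro!: mult_left_mono g)
    finally show ?thesis using suminf_mult2[OF c, of M] by simp
  qed
  have suminf_eq: "suminf f = infsum f UNIV" if "summable (\<lambda>n. cmod (f n))" for f :: "nat \<Rightarrow> complex"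
    using norm_summable_imp_has_sum[OF that summable_sums[OF summable_norm_cancel[OF that]]]
    by (simp add: infsumI)
  have "(\<Sum>n. of_real (c n) * (\<Sum>m. of_real (c m) * g (n + m)))
      = infsum (\<lambda>n. of_real (c n) * infsum (\<lambda>m. of_real (c m) * g (n + m)) UNIV) UNIV"
    using suminf_eq[OF summable_mult_bounded[OF c bnd]] suminf_eq[OF inner] by simp
  also have "\<dots> = infsum (\<lambda>n. infsum (\<lambda>m. F (n, m)) UNIV) UNIV"
    by (simp add: F_def infsum_cmult_right')
  also have "\<dots> = infsum F (UNIV \<times> UNIV)"
    using Fsum by (rule infsum_Sigma_banach)
  also have "\<dots> = infsum (\<lambda>p. F (case p of (k, i) \<Rightarrow> (i, k - i))) (SIGMA k:UNIV. {..k})"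
    \<comment> \<open>Pairs are regrouped along the antidiagonals n + m = k, on which the factor
      \<open>g\<close> is constant.\<close>
    by (rule infsum_reindex_bij_witness[of _ "\<lambda>(k, i). (i, k - i)" "\<lambda>(n, m). (n + m, n)"]) auto
  also have "\<dots> = infsum (\<lambda>k. infsum (\<lambda>i. F (i, k - i)) {..k}) UNIV"
  proof -
    have "(\<lambda>p. F (case p of (k, i) \<Rightarrow> (i, k - i))) summable_on (SIGMA k:UNIV. {..k})"
      by (rule iffD1[OF summable_on_reindex_bij_witness[of _ "\<lambda>(k, i). (i, k - i)" "\<lambda>(n, m). (n + m, n)"] Fsum]) auto
    from infsum_Sigma_banach[OF this] show ?thesis by simp
  qed
  also have "\<dots> = infsum (\<lambda>k. of_real (\<Sum>i\<le>k. c i * c (k - i)) * g k) UNIV"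
    by (simp add: F_def sum_distrib_right mult.assoc)
  also have "\<dots> = (\<Sum>k. of_real (\<Sum>i\<le>k. c i * c (k - i)) * g k)"
  proof (rule suminf_eq[symmetric], rule summable_mult_bounded[OF _ g])
    have "summable (\<lambda>k. \<Sum>i\<le>k. \<bar>c i\<bar> * \<bar>c (k - i)\<bar>)"
      using c by (intro summable_Cauchy_product) auto
    then show "summable (\<lambda>k. \<bar>\<Sum>i\<le>k. c i * c (k - i)\<bar>)"
      by (rule summable_comparison_test[rotated])
        (auto simp: abs_mult[symmetric] intro!: exI[of _ 0] sum_abs)
  qed
  finally show ?thesis .
qed

section \<open>The weak square root of 1 - A for a self-adjoint contraction A\<close>

lemma funpow_in: "(\<And>x. x \<in> C \<Longrightarrow> f x \<in> C) \<Longrightarrow> x \<in> C \<Longrightarrow> (f ^^ n) x \<in> C"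
  by (induction n) auto

text \<open>\<open>D\<close> is the power series of \<open>sqrt (1 - A)\<close>, converging weakly.\<close>
definition is_defect :: "'a hspace \<Rightarrow> ('a \<Rightarrow> 'a) \<Rightarrow> ('a \<Rightarrow> 'a) \<Rightarrow> bool" where
  "is_defect V A D \<longleftrightarrow> (\<forall>y\<in>hcarrier V. D y \<in> hcarrier V \<and>
     (\<forall>x\<in>hcarrier V. (\<lambda>n. of_real (sqrt_coeff n) * hinner V ((A ^^ n) x) y) sums hinner V x (D y)))"

context inner_space
begin

lemma funpow_adj:
  assumes "adj_pair V A A'" "x \<in> hcarrier V" "y \<in> hcarrier V"
  shows "hinner V ((A ^^ n) x) y = hinner V x ((A' ^^ n) y)"
  using assms(3)
proof (induction n arbitrary: y)
  case (Suc n)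
  have "(A ^^ n) x \<in> hcarrier V" by (rule funpow_in[OF adj_pair_in(1)[OF assms(1)] assms(2)])
  then have "hinner V ((A ^^ Suc n) x) y = hinner V ((A ^^ n) x) (A' y)"
    using adj_pair_inner[OF assms(1)] Suc.prems by simp
  also have "\<dots> = hinner V x ((A' ^^ n) (A' y))"
    using Suc.IH adj_pair_in(2)[OF assms(1) Suc.prems] by blast
  finally show ?case by (simp add: funpow_swap1)
qed simp

lemma funpow_contr:
  assumes "contr_pair V A A'" "x \<in> hcarrier V"
  shows "(A ^^ n) x \<in> hcarrier V" "hnorm V ((A ^^ n) x) \<le> hnorm V x"
proof -
  have "(A ^^ n) x \<in> hcarrier V \<and> hnorm V ((A ^^ n) x) \<le> hnorm V x"
    using assms by (induction n) (auto simp: contr_pair_def adj_pair_def intro: order_trans)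
  then show "(A ^^ n) x \<in> hcarrier V" "hnorm V ((A ^^ n) x) \<le> hnorm V x" by auto
qed

lemma funpow_inner_bound:
  assumes "contr_pair V A A'" "x \<in> hcarrier V" "y \<in> hcarrier V"
  shows "cmod (hinner V ((A ^^ n) x) y) \<le> hnorm V y * hnorm V x"
proof -
  have "cmod (hinner V ((A ^^ n) x) y) \<le> hnorm V ((A ^^ n) x) * hnorm V y"
    using cauchy_schwarz funpow_contr[OF assms(1,2)] assms(3) by blast
  also have "\<dots> \<le> hnorm V x * hnorm V y"
    using funpow_contr[OF assms(1,2)] assms(3) by (intro mult_right_mono) auto
  finally show ?thesis by (simp add: mult.commute)
qed

lemma defect_summable:
  assumes "contr_pair V A A'" "x \<in> hcarrier V" "y \<in> hcarrier V"
  shows "summable (\<lambda>n. cmod (of_real (sqrt_coeff n) * hinner V ((A ^^ n) x) y))"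
  using summable_abs_sqrt_coeff funpow_inner_bound[OF assms] by (rule summable_mult_bounded)

text \<open>The coefficients are real and the powers of \<open>A\<close> are self-adjoint, so
  conjugating the series for \<open>D x\<close> yields the series for \<open>D y\<close>.\<close>

lemma defect_adj:
  assumes A: "contr_pair V A A" and D: "is_defect V A D"
  shows "adj_pair V D D"
  unfolding adj_pair_def
proof (intro conjI ballI)
  have A': "adj_pair V A A" using A by (simp add: contr_pair_def)
  fix x y assume x: "x \<in> hcarrier V" and y: "y \<in> hcarrier V"
  have Dx: "D x \<in> hcarrier V" using D x by (auto simp: is_defect_def)
  have "(\<lambda>n. of_real (sqrt_coeff n) * hinner V ((A ^^ n) y) x) sums hinner V y (D x)"
    using D x y by (auto simp: is_defect_def)
  then have "(\<lambda>n. cnj (of_real (sqrt_coeff n) * hinner V ((A ^^ n) y) x)) sums cnj (hinner V y (D x))"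
    by (simp only: sums_cnj)
  moreover have "cnj (of_real (sqrt_coeff n) * hinner V ((A ^^ n) y) x)
      = of_real (sqrt_coeff n) * hinner V ((A ^^ n) x) y" for n
    using funpow_adj[OF A' x y, of n] inner_sym[OF x funpow_contr(1)[OF A y]] by simp
  ultimately have "(\<lambda>n. of_real (sqrt_coeff n) * hinner V ((A ^^ n) x) y) sums hinner V (D x) y"
    by (simp only: inner_sym[OF Dx y])
  moreover have "(\<lambda>n. of_real (sqrt_coeff n) * hinner V ((A ^^ n) x) y) sums hinner V x (D y)"
    using D x y by (auto simp: is_defect_def)
  ultimately show "hinner V (D x) y = hinner V x (D y)" by (rule sums_unique2)
qed (use D in \<open>auto simp: is_defect_def\<close>)

text \<open>\<open>X\<close> intertwines all powers of \<open>A\<close> and \<open>B\<close>, hence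
  the two series term by term. With different \<open>A\<close> and \<open>B\<close> this relates the
  two defect operators of a contraction; with \<open>A\<close> equal to \<open>B\<close> it gives
  commutation.\<close>

lemma defect_intertwine:
  assumes A: "contr_pair V A A" and D: "is_defect V A D"
    and B: "contr_pair V B B" and E: "is_defect V B E"
    and X: "adj_pair V X X'" and XA: "\<And>x. x \<in> hcarrier V \<Longrightarrow> X (A x) = B (X x)"
    and x: "x \<in> hcarrier V"
  shows "X (D x) = E (X x)"
proof (rule inner_eqI')
  note D_in = adj_pair_in(1)[OF defect_adj[OF A D]] and E_in = adj_pair_in(1)[OF defect_adj[OF B E]]
  note X_in = adj_pair_in[OF X]
  show "X (D x) \<in> hcarrier V" "E (X x) \<in> hcarrier V" using x X_in D_in E_in by auto
  fix y assume y: "y \<in> hcarrier V"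
  have pow: "X ((A ^^ n) x) = (B ^^ n) (X x)" for n
    by (induction n) (use XA funpow_contr(1)[OF A x] in auto)
  have "hinner V ((A ^^ n) (X' y)) x = hinner V ((B ^^ n) y) (X x)" for n
  proof -
    have "hinner V ((A ^^ n) (X' y)) x = hinner V (X' y) ((A ^^ n) x)"
      using A x y X_in by (intro funpow_adj) (auto simp: contr_pair_def)
    also have "\<dots> = hinner V y (X ((A ^^ n) x))"
      using adj_pair_inner[OF adj_pair_sym[OF X]] y funpow_contr(1)[OF A x] by blast
    also have "\<dots> = hinner V ((B ^^ n) y) (X x)"
      unfolding pow using B x y X_in by (intro funpow_adj[symmetric]) (auto simp: contr_pair_def)
    finally show ?thesis .
  qed
  moreover have "(\<lambda>n. of_real (sqrt_coeff n) * hinner V ((A ^^ n) (X' y)) x) sums hinner V (X' y) (D x)"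
    using D x y X_in by (auto simp: is_defect_def)
  moreover have "(\<lambda>n. of_real (sqrt_coeff n) * hinner V ((B ^^ n) y) (X x)) sums hinner V y (E (X x))"
    using E x y X_in by (auto simp: is_defect_def)
  ultimately have "hinner V (X' y) (D x) = hinner V y (E (X x))"
    using sums_unique2 by auto
  then show "hinner V y (X (D x)) = hinner V y (E (X x))"
    using adj_pair_inner[OF adj_pair_sym[OF X] y D_in[OF x]] by simp
qed

text \<open>Inserting the series twice gives a double series in \<open>g (n + m)\<close>. Regrouped
  by n + m, its coefficients are those of the squared scalar series, so only
  \<open>g 0 - g 1\<close> survives.\<close>

lemma defect_square:
  assumes A: "contr_pair V A A" and D: "is_defect V A D" and y: "y \<in> hcarrier V"
  shows "D (D y) = hminus V y (A y)"
proof (rule inner_eqI')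
  have D_in: "D z \<in> hcarrier V" if "z \<in> hcarrier V" for z using adj_pair_in(1)[OF defect_adj[OF A D] that] .
  have A': "adj_pair V A A" using A by (simp add: contr_pair_def)
  show "D (D y) \<in> hcarrier V" "hminus V y (A y) \<in> hcarrier V" using y D_in adj_pair_in(1)[OF A'] by auto
  fix x assume x: "x \<in> hcarrier V"
  define g where "g n = hinner V ((A ^^ n) x) y" for n
  let ?c = "\<lambda>n. complex_of_real (sqrt_coeff n)"
  have inner: "hinner V ((A ^^ n) x) (D y) = (\<Sum>m. ?c m * g (n + m))" for n
  proof -
    have "(\<lambda>m. ?c m * hinner V ((A ^^ m) ((A ^^ n) x)) y) sums hinner V ((A ^^ n) x) (D y)"
      using D y funpow_contr(1)[OF A x] by (auto simp: is_defect_def)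
    then show ?thesis by (simp add: g_def sums_iff funpow_add add.commute[of n])
  qed
  have "hinner V x (D (D y)) = (\<Sum>n. ?c n * hinner V ((A ^^ n) x) (D y))"
    using D x D_in[OF y] by (auto simp: is_defect_def sums_iff)
  also have "\<dots> = (\<Sum>n. ?c n * (\<Sum>m. ?c m * g (n + m)))" by (simp add: inner)
  also have "\<dots> = (\<Sum>k. of_real (\<Sum>i\<le>k. sqrt_coeff i * sqrt_coeff (k - i)) * g k)"
    unfolding g_def
    by (rule double_sum_antidiagonal[OF summable_abs_sqrt_coeff funpow_inner_bound[OF A x y]])
  also have "\<dots> = (\<Sum>k\<in>{0, 1}. of_real (\<Sum>i\<le>k. sqrt_coeff i * sqrt_coeff (k - i)) * g k)"
    by (rule suminf_finite) (auto simp: sqrt_coeff_convolution)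
  also have "\<dots> = g 0 - g 1" by (simp add: sqrt_coeff_convolution)
  also have "\<dots> = hinner V x (hminus V y (A y))"
    using x y adj_pair_in(1)[OF A'] adj_pair_inner[OF A'] by (simp add: g_def)
  finally show "hinner V x (D (D y)) = hinner V x (hminus V y (A y))" .
qed

end

text \<open>For fixed \<open>y\<close> the series is a linear functional of \<open>x\<close>,
  bounded by the absolute sum of the coefficients times both norms; its Riesz vector serves as
  \<open>D y\<close>.\<close>

lemma (in hilbert) defect_exists:
  assumes A: "contr_pair V A A"
  shows "\<exists>D. is_defect V A D"
proof -
  have A': "adj_pair V A A" using A by (simp add: contr_pair_def)
  let ?f = "\<lambda>y x. \<Sum>n. of_real (sqrt_coeff n) * hinner V ((A ^^ n) x) y"
  note summ = defect_summable[OF A]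
  have summ': "summable (\<lambda>n. of_real (sqrt_coeff n) * hinner V ((A ^^ n) x) y)"
    if "x \<in> hcarrier V" "y \<in> hcarrier V" for x y
    using summable_norm_cancel[OF summ[OF that]] .
  have "\<exists>z\<in>hcarrier V. \<forall>x\<in>hcarrier V. ?f y x = hinner V x z" if y: "y \<in> hcarrier V" for y
  proof (rule riesz)
    have in_pow: "(A ^^ n) x \<in> hcarrier V" if "x \<in> hcarrier V" for n x using funpow_contr(1)[OF A that] .
    have add: "(A ^^ n) (hadd V u v) = hadd V ((A ^^ n) u) ((A ^^ n) v)" if "u \<in> hcarrier V" "v \<in> hcarrier V" for n u v
      by (induction n) (use that in_pow adj_pair_add[OF A'] in auto)
    have scale: "(A ^^ n) (hscale V c u) = hscale V c ((A ^^ n) u)" if "u \<in> hcarrier V" for n u c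
      by (induction n) (use that in_pow adj_pair_scale[OF A'] in auto)
    show "?f y (hadd V u v) = ?f y u + ?f y v" if "u \<in> hcarrier V" "v \<in> hcarrier V" for u v
      using that y by (simp add: add in_pow suminf_add summ' ring_distribs)
    show "?f y (hscale V c u) = c * ?f y u" if "u \<in> hcarrier V" for c u
    proof -
      have "?f y (hscale V c u) = (\<Sum>n. c * (of_real (sqrt_coeff n) * hinner V ((A ^^ n) u) y))"
        using that y by (simp add: scale in_pow mult.left_commute)
      then show ?thesis using suminf_mult[OF summ'[OF that y]] by simp
    qed
    show "cmod (?f y x) \<le> ((\<Sum>n. \<bar>sqrt_coeff n\<bar>) * hnorm V y) * hnorm V x" if x: "x \<in> hcarrier V" for x
    proof -
      have "cmod (?f y x) \<le> (\<Sum>n. cmod (of_real (sqrt_coeff n) * hinner V ((A ^^ n) x) y))"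
        by (rule summable_norm[OF summ[OF x y]])
      also have "\<dots> \<le> (\<Sum>n. \<bar>sqrt_coeff n\<bar> * (hnorm V y * hnorm V x))"
        by (rule suminf_le[OF _ summ[OF x y] summable_mult2[OF summable_abs_sqrt_coeff]])
          (auto simp: norm_mult intro!: mult_left_mono funpow_inner_bound[OF A x y])
      also have "\<dots> = (\<Sum>n. \<bar>sqrt_coeff n\<bar>) * (hnorm V y * hnorm V x)"
        by (rule suminf_mult2[OF summable_abs_sqrt_coeff, symmetric])
      finally show ?thesis by simp
    qed
  qed
  then obtain D where "\<And>y. y \<in> hcarrier V \<Longrightarrow> D y \<in> hcarrier V"
    "\<And>x y. x \<in> hcarrier V \<Longrightarrow> y \<in> hcarrier V \<Longrightarrow> ?f y x = hinner V x (D y)" by metis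
  then have "is_defect V A D" using summ' by (auto simp: is_defect_def sums_iff)
  then show ?thesis by blast
qed

section \<open>The space of square summable sequences\<close>

text \<open>The bijection \<open>dec\<close> lets sequences indexed by \<open>\<int>\<close> live in a prescribed type; with
  \<open>'b = nat \<Rightarrow> 'h\<close> the construction can be iterated without leaving that type.\<close>
definition l2space :: "('b \<Rightarrow> int \<Rightarrow> 'a) \<Rightarrow> 'a hspace \<Rightarrow> 'b hspace" where
  "l2space dec V = \<lparr>
     hcarrier = {z. (\<forall>n. dec z n \<in> hcarrier V) \<and> (\<lambda>n. (hnorm V (dec z n))\<^sup>2) summable_on UNIV},
     hzero = inv dec (\<lambda>_. hzero V),
     hadd = (\<lambda>x y. inv dec (\<lambda>n. hadd V (dec x n) (dec y n))),
     hscale = (\<lambda>c x. inv dec (\<lambda>n. hscale V c (dec x n))),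
     hinner = (\<lambda>x y. infsum (\<lambda>n. hinner V (dec x n) (dec y n)) UNIV)\<rparr>"

text \<open>Meant for the adjoint identity of the Schaeffer matrix, where two series agree term by
  term except at two places, at which only the sums of the terms match.\<close>

lemma infsum_eq_if_eq_off_finite:
  fixes f g :: "'i \<Rightarrow> complex"
  assumes "f summable_on UNIV" "g summable_on UNIV" "finite F"
    and "\<And>n. n \<notin> F \<Longrightarrow> f n = g n" "sum f F = sum g F"
  shows "infsum f UNIV = infsum g UNIV"
proof -
  have split: "infsum h UNIV = sum h F + infsum h (- F)" if "h summable_on UNIV" for h :: "'i \<Rightarrow> complex"
    using infsum_Un_disjoint[of h F "- F"] that assms(3) summable_on_subset_banach[of h UNIV "- F"] by simp
  have "infsum f (- F) = infsum g (- F)" using assms(4) by (intro infsum_cong) auto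
  then show ?thesis using assms(5) by (simp add: split[OF assms(1)] split[OF assms(2)])
qed

locale l2 = inner_space V for V :: "'a hspace" +
  fixes dec :: "'b \<Rightarrow> int \<Rightarrow> 'a"
  assumes bij_dec: "bij dec"
begin

abbreviation "K \<equiv> l2space dec V"

lemma dec_inv [simp]: "dec (inv dec f) = f"
  using bij_dec by (simp add: bij_is_surj surj_f_inv_f)

lemma dec_eqI: "(\<And>n. dec x n = dec y n) \<Longrightarrow> x = y"
  using bij_dec by (metis bij_is_inj ext injD)

lemma sq_summable: "z \<in> hcarrier K \<Longrightarrow> (\<lambda>n. (hnorm V (dec z n))\<^sup>2) summable_on UNIV"
  by (simp add: l2space_def)

lemma carrierI: "(\<And>n. dec z n \<in> hcarrier V) \<Longrightarrow> (\<lambda>n. (hnorm V (dec z n))\<^sup>2) summable_on UNIV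
    \<Longrightarrow> z \<in> hcarrier K"
  by (simp add: l2space_def)

lemma dec_zero [simp]: "dec (hzero K) n = hzero V"
  and dec_add [simp]: "dec (hadd K x y) n = hadd V (dec x n) (dec y n)"
  and dec_scale [simp]: "dec (hscale K c x) n = hscale V c (dec x n)"
  and dec_minus [simp]: "dec (hminus K x y) n = hminus V (dec x n) (dec y n)"
  by (simp_all add: l2space_def hminus_def)

lemma inner_l2: "hinner K x y = infsum (\<lambda>n. hinner V (dec x n) (dec y n)) UNIV"
  by (simp add: l2space_def)

lemma dec_in [simp]: "z \<in> hcarrier K \<Longrightarrow> dec z n \<in> hcarrier V"
  by (simp add: l2space_def)

lemma inner_summable:
  assumes x: "x \<in> hcarrier K" and y: "y \<in> hcarrier K"
  shows "(\<lambda>n. hinner V (dec x n) (dec y n)) summable_on UNIV"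
proof (rule abs_summable_summable, rule summable_on_comparison_test)
  show "(\<lambda>n. (hnorm V (dec x n))\<^sup>2 + (hnorm V (dec y n))\<^sup>2) summable_on UNIV"
    by (intro summable_on_add sq_summable x y)
  show "cmod (hinner V (dec x n) (dec y n)) \<le> (hnorm V (dec x n))\<^sup>2 + (hnorm V (dec y n))\<^sup>2" for n
  proof -
    let ?a = "hnorm V (dec x n)" and ?b = "hnorm V (dec y n)"
    have "cmod (hinner V (dec x n) (dec y n)) \<le> ?a * ?b" using x y by (intro cauchy_schwarz) auto
    moreover have "0 \<le> (?a - ?b)\<^sup>2" by simp
    moreover have "0 \<le> ?a * ?b" using x y by simp
    ultimately show ?thesis by (simp add: power2_diff)
  qed
qed simp

lemma carrier_if_le:
  assumes "\<And>n. dec z n \<in> hcarrier V" "f summable_on UNIV" "\<And>n. (hnorm V (dec z n))\<^sup>2 \<le> f n"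
  shows "z \<in> hcarrier K"
  using assms(1) by (rule carrierI) (rule summable_on_comparison_test[OF assms(2)], use assms(3) in auto)

sublocale l2: inner_space K
proof
  show "hzero K \<in> hcarrier K"
    by (rule carrier_if_le[where f = "\<lambda>_. 0"]) (simp_all add: hnorm_def)
  show "hadd K x y \<in> hcarrier K" if "x \<in> hcarrier K" "y \<in> hcarrier K" for x y
    by (rule carrier_if_le[where f = "\<lambda>n. 2 * (hnorm V (dec x n))\<^sup>2 + 2 * (hnorm V (dec y n))\<^sup>2"])
      (use that in \<open>auto intro!: hnorm_add_sq_le summable_on_add summable_on_cmult_right sq_summable\<close>)
  show "hscale K c x \<in> hcarrier K" if "x \<in> hcarrier K" for x c
    by (rule carrier_if_le[where f = "\<lambda>n. (cmod c)\<^sup>2 * (hnorm V (dec x n))\<^sup>2"])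
      (use that in \<open>auto simp: hnorm_scale power_mult_distrib intro!: summable_on_cmult_right sq_summable\<close>)
  show "hinner K (hzero K) x = 0" if "x \<in> hcarrier K" for x
    using that by (simp add: inner_l2)
  show "hinner K (hadd K x y) z = hinner K x z + hinner K y z"
    if "x \<in> hcarrier K" "y \<in> hcarrier K" "z \<in> hcarrier K" for x y z
    using that by (simp add: inner_l2 infsum_add inner_summable)
  show "hinner K (hscale K c x) y = c * hinner K x y"
    if "x \<in> hcarrier K" "y \<in> hcarrier K" for x y c
    using that by (simp add: inner_l2 infsum_cmult_right')
  show "hinner K x y = cnj (hinner K y x)" if "x \<in> hcarrier K" "y \<in> hcarrier K" for x y
    unfolding inner_l2 infsum_cnj[symmetric] using that by (intro infsum_cong inner_sym) auto
  show "0 \<le> Re (hinner K x x)" if "x \<in> hcarrier K" for x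
    unfolding inner_l2 infsum_Re[OF inner_summable[OF that that], symmetric]
    using that by (intro infsum_nonneg inner_nonneg) auto
  show "x = y" if x: "x \<in> hcarrier K" and y: "y \<in> hcarrier K"
    and 0: "hinner K (hminus K x y) (hminus K x y) = 0" for x y
  proof (rule dec_eqI, rule eq_if_dist_zero)
    fix n
    let ?d = "\<lambda>n. hminus V (dec x n) (dec y n)"
    have d: "?d n \<in> hcarrier V" for n using x y by simp
    \<comment> \<open>That the carrier is closed under \<open>hminus\<close> is a consequence of the
      locale still being established, so square summability of the difference is derived here
      directly.\<close>
    have "(\<lambda>n. 2 * (hnorm V (dec x n))\<^sup>2 + 2 * (hnorm V (dec y n))\<^sup>2) summable_on UNIV"
      by (intro summable_on_add summable_on_cmult_right sq_summable x y)
    then have summ: "(\<lambda>n. (hnorm V (?d n))\<^sup>2) summable_on UNIV"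
    proof (rule summable_on_comparison_test)
      show "(hnorm V (?d n))\<^sup>2 \<le> 2 * (hnorm V (dec x n))\<^sup>2 + 2 * (hnorm V (dec y n))\<^sup>2" for n
        using hnorm_add_sq_le[of "dec x n" "hscale V (-1) (dec y n)"] x y by (simp add: hminus_def hnorm_scale)
    qed simp
    have "infsum (\<lambda>n. complex_of_real ((hnorm V (?d n))\<^sup>2)) UNIV = 0"
      using 0 by (simp add: inner_l2 inner_self_hnorm[OF d] del: inner_minus_left inner_minus_right)
    then have "infsum (\<lambda>n. (hnorm V (?d n))\<^sup>2) UNIV = 0"
      unfolding infsumI[OF iffD2[OF has_sum_of_real_iff has_sum_infsum[OF summ]]]
      by (rule of_real_eq_0_iff[THEN iffD1])
    then have "(hnorm V (?d n))\<^sup>2 = 0"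
      using nonneg_infsum_le_0D[OF _ summ, of n] by simp
    then show "hinner V (?d n) (?d n) = 0" by (simp add: inner_self_hnorm[OF d] del: inner_minus_left inner_minus_right)
  qed (use x y in auto)
qed

lemma hnorm_l2: "z \<in> hcarrier K \<Longrightarrow> (hnorm K z)\<^sup>2 = infsum (\<lambda>n. (hnorm V (dec z n))\<^sup>2) UNIV"
  by (simp add: l2.hnorm_sq inner_l2 infsum_Re[symmetric] inner_summable hnorm_sq)

lemma sum_coord_le:
  assumes "z \<in> hcarrier K" "finite F"
  shows "(\<Sum>n\<in>F. (hnorm V (dec z n))\<^sup>2) \<le> (hnorm K z)\<^sup>2"
  unfolding hnorm_l2[OF assms(1)] by (rule finite_sum_le_infsum[OF sq_summable[OF assms(1)] assms(2)]) auto

lemma coord_le: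
  assumes "z \<in> hcarrier K"
  shows "hnorm V (dec z n) \<le> hnorm K z"
proof (rule power2_le_imp_le)
  show "(hnorm V (dec z n))\<^sup>2 \<le> (hnorm K z)\<^sup>2"
    using sum_coord_le[OF assms, of "{n}"] by simp
qed (use assms in simp)

text \<open>Reduces membership and norm bounds to finitely many coordinates at a time, where limits
  can be taken freely.\<close>

lemma hnorm_le_if_sums_le:
  assumes z: "\<And>n. dec z n \<in> hcarrier V"
    and bound: "\<And>F. finite F \<Longrightarrow> (\<Sum>n\<in>F. (hnorm V (dec z n))\<^sup>2) \<le> e\<^sup>2" and "0 \<le> e"
  shows "z \<in> hcarrier K" "hnorm K z \<le> e"
proof -
  have "(\<lambda>n. (hnorm V (dec z n))\<^sup>2) summable_on UNIV"
    by (rule nonneg_bdd_above_summable_on) (use bound in \<open>auto intro!: bdd_aboveI2\<close>)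
  then show "z \<in> hcarrier K" using z by (intro carrierI)
  then have "(hnorm K z)\<^sup>2 \<le> e\<^sup>2"
    using bound infsum_le_finite_sums[OF sq_summable] by (simp add: hnorm_l2)
  then show "hnorm K z \<le> e" using \<open>0 \<le> e\<close> by (rule power2_le_imp_le)
qed

text \<open>\<open>l\<close> is recovered as x - (x - l). This places the coordinatewise limit of a
  Cauchy sequence in the space.\<close>

lemma carrier_if_diff_carrier:
  assumes x: "x \<in> hcarrier K" and d: "hminus K x l \<in> hcarrier K" and l: "\<And>n. dec l n \<in> hcarrier V"
  shows "l \<in> hcarrier K"
proof -
  have "l = hminus K x (hminus K x l)"
    by (rule dec_eqI, rule inner_eqI) (use x l in auto)
  then show ?thesis using x d l2.minus_in by metis
qed

end

section \<open>Completeness of the sequence space\<close>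

locale l2_hilbert = hilbert V + l2 V dec for V :: "'a hspace" and dec :: "'b \<Rightarrow> int \<Rightarrow> 'a"
begin

sublocale l2: hilbert K
proof
  fix f :: "nat \<Rightarrow> 'b"
  assume f: "\<And>n. f n \<in> hcarrier K"
    and cauchy: "\<forall>e>0. \<exists>N. \<forall>m\<ge>N. \<forall>n\<ge>N. hnorm K (hminus K (f m) (f n)) < e"
  have "\<exists>l\<in>hcarrier V. (\<lambda>m. hnorm V (hminus V (dec (f m) n) l)) \<longlonglongrightarrow> 0" for n
  proof (rule complete)
    show "\<forall>e>0. \<exists>N. \<forall>m\<ge>N. \<forall>p\<ge>N. hnorm V (hminus V (dec (f m) n) (dec (f p) n)) < e"
    proof (intro allI impI)
      fix e :: real assume "e > 0"
      then obtain N where N: "\<And>m p. m \<ge> N \<Longrightarrow> p \<ge> N \<Longrightarrow> hnorm K (hminus K (f m) (f p)) < e" using cauchy by blast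
      have "hnorm V (hminus V (dec (f m) n) (dec (f p) n)) \<le> hnorm K (hminus K (f m) (f p))" for m p
        using coord_le[of "hminus K (f m) (f p)" n] f by simp
      then show "\<exists>N. \<forall>m\<ge>N. \<forall>p\<ge>N. hnorm V (hminus V (dec (f m) n) (dec (f p) n)) < e"
        using N order_le_less_trans by blast
    qed
  qed (use f in simp)
  then obtain l0 where l0: "\<And>n. l0 n \<in> hcarrier V" "\<And>n. (\<lambda>m. hnorm V (hminus V (dec (f m) n) (l0 n))) \<longlonglongrightarrow> 0"
    by metis
  define l where "l = inv dec l0"
  have le: "\<exists>N. \<forall>m\<ge>N. hminus K (f m) l \<in> hcarrier K \<and> hnorm K (hminus K (f m) l) \<le> e" if e: "e > 0" for e
  proof -
    obtain N where N: "\<And>m p. m \<ge> N \<Longrightarrow> p \<ge> N \<Longrightarrow> hnorm K (hminus K (f m) (f p)) < e" using cauchy e by blast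
    have "hminus K (f m) l \<in> hcarrier K \<and> hnorm K (hminus K (f m) l) \<le> e" if m: "m \<ge> N" for m
    proof -
      \<comment> \<open>On a finite set of coordinates the Cauchy estimate survives the limit in
        \<open>p\<close>; since the bound does not depend on \<open>F\<close>, it passes to the
        whole norm.\<close>
      have bound: "(\<Sum>n\<in>F. (hnorm V (dec (hminus K (f m) l) n))\<^sup>2) \<le> e\<^sup>2" if F: "finite F" for F
      proof -
        have "(\<lambda>p. \<Sum>n\<in>F. (hnorm V (hminus V (dec (f m) n) (dec (f p) n)))\<^sup>2)
            \<longlonglongrightarrow> (\<Sum>n\<in>F. (hnorm V (hminus V (dec (f m) n) (l0 n)))\<^sup>2)"
          using f l0 by (intro tendsto_sum tendsto_power hnorm_diff_tendsto) auto
        moreover have "(\<Sum>n\<in>F. (hnorm V (hminus V (dec (f m) n) (dec (f p) n)))\<^sup>2) \<le> e\<^sup>2" if "p \<ge> N" for p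
        proof -
          have "(\<Sum>n\<in>F. (hnorm V (hminus V (dec (f m) n) (dec (f p) n)))\<^sup>2) \<le> (hnorm K (hminus K (f m) (f p)))\<^sup>2"
            using sum_coord_le[of "hminus K (f m) (f p)" F] f F by simp
          also have "\<dots> \<le> e\<^sup>2" using N[OF m that] f by (intro power_mono) auto
          finally show ?thesis .
        qed
        ultimately show ?thesis
          unfolding l_def by (auto intro: LIMSEQ_le_const2)
      qed
      have "dec (hminus K (f m) l) n \<in> hcarrier V" for n using f l0 by (simp add: l_def)
      from hnorm_le_if_sums_le[OF this bound] show ?thesis using e by simp
    qed
    then show ?thesis by blast
  qed
  have "l \<in> hcarrier K"
    using le[of 1] f l0 carrier_if_diff_carrier[of "f _" l] by (fastforce simp: l_def)
  moreover have "(\<lambda>n. hnorm K (hminus K (f n) l)) \<longlonglongrightarrow> 0"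
  proof (rule LIMSEQ_I)
    fix r :: real assume "r > 0"
    \<comment> \<open>The limit preserved only a non-strict bound, hence the half.\<close>
    then obtain N where "\<forall>m\<ge>N. hminus K (f m) l \<in> hcarrier K \<and> hnorm K (hminus K (f m) l) \<le> r / 2"
      using le[of "r / 2"] by auto
    then show "\<exists>N. \<forall>n\<ge>N. norm (hnorm K (hminus K (f n) l) - 0) < r"
      using \<open>r > 0\<close> by (fastforce intro!: exI[of _ N])
  qed
  ultimately show "\<exists>l\<in>hcarrier K. (\<lambda>n. hnorm K (hminus K (f n) l)) \<longlonglongrightarrow> 0" by blast
qed

end

section \<open>The dilation of one operator\<close>

context l2
begin

text \<open>One criterion for the maps that are not diagonal: the embedding (a shift by 0 of the
  zero sequence, changed at index 0), and the Schaeffer matrix and its adjoint, which shift by one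
  outside two coordinates.\<close>

lemma shift_carrier:
  assumes z: "z \<in> hcarrier K" and f: "\<And>n. f n \<in> hcarrier V"
    and F: "finite F" and eq: "\<And>n. n \<notin> F \<Longrightarrow> f n = dec z (n + s)"
  shows "inv dec f \<in> hcarrier K"
proof (rule carrierI)
  let ?h = "\<lambda>n. (hnorm V (f n))\<^sup>2"
  have "bij_betw (\<lambda>n. n + s) UNIV UNIV"
    by (rule bij_betw_byWitness[where f' = "\<lambda>n. n - s"]) auto
  from summable_on_reindex_bij_betw[OF this, of "\<lambda>n. (hnorm V (dec z n))\<^sup>2"] sq_summable[OF z]
  have "(\<lambda>n. (hnorm V (dec z (n + s)))\<^sup>2) summable_on UNIV" by simp
  then have "(\<lambda>n. (hnorm V (dec z (n + s)))\<^sup>2) summable_on (- F)"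
    by (rule summable_on_subset_banach) simp
  then have "?h summable_on (- F)" by (rule summable_on_cong[THEN iffD2, rotated]) (simp add: eq)
  then have "?h summable_on (F \<union> - F)" using F by (intro summable_on_Un_disjoint) auto
  then show "(\<lambda>n. (hnorm V (dec (inv dec f) n))\<^sup>2) summable_on UNIV" by simp
qed (simp add: f)

section \<open>Diagonal extensions and the embedding at index 0\<close>

definition diag_op :: "(int \<Rightarrow> complex) \<Rightarrow> ('a \<Rightarrow> 'a) \<Rightarrow> 'b \<Rightarrow> 'b" where
  "diag_op c S z = inv dec (\<lambda>n. hscale V (c n) (S (dec z n)))"

lemma dec_diag_op [simp]: "dec (diag_op c S z) n = hscale V (c n) (S (dec z n))"
  by (simp add: diag_op_def)

lemma diag_op_carrier:
  assumes S: "contr_pair V S S'" and c: "\<And>n. cmod (c n) = 1" and z: "z \<in> hcarrier K"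
  shows "diag_op c S z \<in> hcarrier K"
proof (rule carrier_if_le[OF _ sq_summable[OF z]])
  have in': "S (dec z n) \<in> hcarrier V" and le: "hnorm V (S (dec z n)) \<le> hnorm V (dec z n)" for n
    using S z by (auto simp: contr_pair_def adj_pair_in)
  show "dec (diag_op c S z) n \<in> hcarrier V" for n using in' by simp
  show "(hnorm V (dec (diag_op c S z) n))\<^sup>2 \<le> (hnorm V (dec z n))\<^sup>2" for n
    using le in' by (simp add: hnorm_scale c power_mono)
qed

lemma diag_op_contr:
  assumes S: "contr_pair V S S'" and c: "\<And>n. cmod (c n) = 1"
  shows "contr_pair K (diag_op c S) (diag_op (\<lambda>n. cnj (c n)) S')"
  unfolding contr_pair_def adj_pair_def
proof (intro conjI ballI)
  note in' = diag_op_carrier[OF S c] diag_op_carrier[OF contr_pair_sym[OF S], of "\<lambda>n. cnj (c n)"]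
  fix x assume x: "x \<in> hcarrier K"
  show x1: "diag_op c S x \<in> hcarrier K" and "diag_op (\<lambda>n. cnj (c n)) S' x \<in> hcarrier K"
    using in' x c by auto
  have S_in: "S (dec x n) \<in> hcarrier V" "hnorm V (S (dec x n)) \<le> hnorm V (dec x n)" for n
    using S x by (auto simp: contr_pair_def adj_pair_in)
  have "(hnorm K (diag_op c S x))\<^sup>2 \<le> (hnorm K x)\<^sup>2"
    unfolding hnorm_l2[OF x1] hnorm_l2[OF x] using S_in sq_summable[OF x1]
    by (intro infsum_mono sq_summable x1 x) (simp add: hnorm_scale c power_mono)
  then show "hnorm K (diag_op c S x) \<le> hnorm K x" by (rule power2_le_imp_le) (use x in simp)
  fix y assume y: "y \<in> hcarrier K"
  show "hinner K (diag_op c S x) y = hinner K x (diag_op (\<lambda>n. cnj (c n)) S' y)"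
    unfolding inner_l2 using S x y S_in
    by (intro infsum_cong) (auto simp: contr_pair_def adj_pair_def)
qed

lemma diag_op_unitary:
  assumes S: "unitary_pair V S S'" and c: "\<And>n. cmod (c n) = 1"
  shows "unitary_pair K (diag_op c S) (diag_op (\<lambda>n. cnj (c n)) S')"
proof -
  have cc: "c n * cnj (c n) = 1" for n using c[of n] by (rule unit_cnj)
  have SS: "adj_pair V S S'" using S by (simp add: unitary_pair_def)
  have "diag_op c S (diag_op (\<lambda>n. cnj (c n)) S' z) = z \<and> diag_op (\<lambda>n. cnj (c n)) S' (diag_op c S z) = z"
    if z: "z \<in> hcarrier K" for z
  proof (intro conjI dec_eqI)
    fix n
    have d: "dec z n \<in> hcarrier V" using z by simp
    show "dec (diag_op c S (diag_op (\<lambda>n. cnj (c n)) S' z)) n = dec z n"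
      "dec (diag_op (\<lambda>n. cnj (c n)) S' (diag_op c S z)) n = dec z n"
      using d S cc adj_pair_in[OF SS d]
      by (simp_all add: adj_pair_scale[OF SS] adj_pair_scale[OF adj_pair_sym[OF SS]]
          scale_scale scale_one unitary_pair_def mult.commute)
  qed
  then show ?thesis
    using diag_op_contr[OF unitary_pair_contr[OF S] c] by (auto simp: unitary_pair_def contr_pair_def)
qed

text \<open>The weights are scalars and pass through \<open>S\<close> and \<open>R\<close>, so the
  phase survives whatever the two weight sequences are. This settles pairs of operators neither of
  which is being dilated.\<close>

lemma diag_op_commute:
  assumes S: "adj_pair V S S'" and R: "adj_pair V R R'"
    and SR: "\<And>x. x \<in> hcarrier V \<Longrightarrow> S (R x) = hscale V a (R (S x))"
    and z: "z \<in> hcarrier K"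
  shows "diag_op c S (diag_op d R z) = hscale K a (diag_op d R (diag_op c S z))"
proof (rule dec_eqI)
  fix n
  have x: "dec z n \<in> hcarrier V" using z by simp
  show "dec (diag_op c S (diag_op d R z)) n = dec (hscale K a (diag_op d R (diag_op c S z))) n"
    using adj_pair_in[OF S x] adj_pair_in[OF R x] adj_pair_in[OF S adj_pair_in(1)[OF R x]]
      adj_pair_in[OF R adj_pair_in(1)[OF S x]] x
    by (simp add: adj_pair_scale[OF S] adj_pair_scale[OF R] SR scale_scale mult_ac)
qed

definition emb :: "'a \<Rightarrow> 'b" where
  "emb x = inv dec (\<lambda>n. if n = 0 then x else hzero V)"

lemma dec_emb [simp]: "dec (emb x) n = (if n = 0 then x else hzero V)"
  by (simp add: emb_def)

lemma emb_in [simp]: "x \<in> hcarrier V \<Longrightarrow> emb x \<in> hcarrier K"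
  unfolding emb_def by (rule shift_carrier[where z = "hzero K" and F = "{0}" and s = 0]) auto

lemma inner_emb:
  assumes "z \<in> hcarrier K" "x \<in> hcarrier V"
  shows "hinner K z (emb x) = hinner V (dec z 0) x"
proof -
  have "hinner K z (emb x) = infsum (\<lambda>n. hinner V (dec z n) (dec (emb x) n)) {0}"
    unfolding inner_l2 using assms by (intro infsum_cong_neutral) auto
  then show ?thesis by simp
qed

lemma emb_isometric: "isometric_embedding V K emb"
proof -
  have "emb (hadd V x y) = hadd K (emb x) (emb y)" if "x \<in> hcarrier V" "y \<in> hcarrier V" for x y
    by (rule dec_eqI) (use that in \<open>simp add: zero_add\<close>)
  moreover have "emb (hscale V c x) = hscale K c (emb x)" if "x \<in> hcarrier V" for c x
    by (rule dec_eqI) (use that in \<open>simp add: scale_zero\<close>)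
  ultimately show ?thesis by (simp add: isometric_embedding_def inner_emb)
qed

text \<open>With weight 1 at index 0 the extension acts on the embedded copy as \<open>S\<close>
  itself, not just after compression.\<close>

lemma diag_op_emb:
  assumes S: "adj_pair V S S'" and c: "c 0 = 1" and x: "x \<in> hcarrier V"
  shows "diag_op c S (emb x) = emb (S x)"
  by (rule dec_eqI) (use adj_pair_in(1)[OF S x] in \<open>simp add: scale_zero adj_pair_zero[OF S] scale_one c\<close>)

end

text \<open>These relations are what unitarity of the rotation matrix consumes: the squares
  \<open>DD\<close> and \<open>EE\<close> give the diagonal entries of its products with its
  adjoint, and \<open>TD\<close> together with its adjoint relation cancels the others.\<close>

locale dilation = l2 V dec for V :: "'a hspace" and dec :: "'b \<Rightarrow> int \<Rightarrow> 'a" +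
  fixes T T' D E :: "'a \<Rightarrow> 'a"
  assumes T: "adj_pair V T T'" and D: "adj_pair V D D" and E: "adj_pair V E E"
    and DD: "\<And>x. x \<in> hcarrier V \<Longrightarrow> D (D x) = hminus V x (T' (T x))"
    and EE: "\<And>x. x \<in> hcarrier V \<Longrightarrow> E (E x) = hminus V x (T (T' x))"
    and TD: "\<And>x. x \<in> hcarrier V \<Longrightarrow> T (D x) = E (T x)"
begin

lemmas T' = adj_pair_sym[OF T]
lemmas ops_in [simp] = adj_pair_in[OF T] adj_pair_in(1)[OF D] adj_pair_in(1)[OF E]
lemmas ops_add = adj_pair_add[OF T] adj_pair_add[OF T'] adj_pair_add[OF D] adj_pair_add[OF E]
lemmas ops_minus = adj_pair_minus[OF T] adj_pair_minus[OF T'] adj_pair_minus[OF D] adj_pair_minus[OF E]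
lemmas ops_scale = adj_pair_scale[OF T] adj_pair_scale[OF T'] adj_pair_scale[OF D] adj_pair_scale[OF E]
lemmas ops_zero = adj_pair_zero[OF T] adj_pair_zero[OF T'] adj_pair_zero[OF D] adj_pair_zero[OF E]

lemma T'E: "x \<in> hcarrier V \<Longrightarrow> T' (E x) = D (T' x)"
  by (rule inner_eqI) (simp_all add: adj_pair_inner[OF T'] adj_pair_inner[OF D] adj_pair_inner[OF E] TD)

text \<open>Up to the right shift, the Schaeffer dilation is the rotation matrix with rows
  \<open>(T, D\<^sub>*)\<close> and \<open>(D, - T\<^sup>*)\<close>, where \<open>D\<^sub>*\<close> is called \<open>E\<close>.\<close>
definition dil :: "'b \<Rightarrow> 'b" where
  "dil z = inv dec (\<lambda>n. if n = 0 then hadd V (T (dec z 0)) (E (dec z (-1)))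
     else if n = 1 then hminus V (D (dec z 0)) (T' (dec z (-1))) else dec z (n - 1))"

definition dil_adj :: "'b \<Rightarrow> 'b" where
  "dil_adj z = inv dec (\<lambda>n. if n = 0 then hadd V (T' (dec z 0)) (D (dec z 1))
     else if n = -1 then hminus V (E (dec z 0)) (T (dec z 1)) else dec z (n + 1))"

lemma dec_dil: "dec (dil z) n = (if n = 0 then hadd V (T (dec z 0)) (E (dec z (-1)))
     else if n = 1 then hminus V (D (dec z 0)) (T' (dec z (-1))) else dec z (n - 1))"
  by (simp add: dil_def)

lemma dec_dil_adj: "dec (dil_adj z) n = (if n = 0 then hadd V (T' (dec z 0)) (D (dec z 1))
     else if n = -1 then hminus V (E (dec z 0)) (T (dec z 1)) else dec z (n + 1))"
  by (simp add: dil_adj_def)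

lemma dil_in [simp]: "z \<in> hcarrier K \<Longrightarrow> dil z \<in> hcarrier K"
  unfolding dil_def by (rule shift_carrier[where z = z and F = "{0, 1}" and s = "-1"]) auto

lemma dil_adj_in [simp]: "z \<in> hcarrier K \<Longrightarrow> dil_adj z \<in> hcarrier K"
  unfolding dil_adj_def by (rule shift_carrier[where z = z and F = "{0, -1}" and s = 1]) auto

text \<open>After the index is shifted by one, the series differ only at 0 and 1; there, moving each
  of the four matrix entries to the other side matches the terms after addition.\<close>

lemma dil_adjoint:
  assumes x: "x \<in> hcarrier K" and y: "y \<in> hcarrier K"
  shows "hinner K (dil x) y = hinner K x (dil_adj y)"
proof -
  let ?a = "\<lambda>n. hinner V (dec (dil x) n) (dec y n)"
  let ?b = "\<lambda>n. hinner V (dec x n) (dec (dil_adj y) n)"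
  have bij: "bij_betw (\<lambda>n. n - 1 :: int) UNIV UNIV"
    by (rule bij_betw_byWitness[where f' = "\<lambda>n. n + 1"]) auto
  have "infsum ?a UNIV = infsum (\<lambda>n. ?b (n - 1)) UNIV"
  proof (rule infsum_eq_if_eq_off_finite[where F = "{0, 1}"])
    show "(\<lambda>n. ?b (n - 1)) summable_on UNIV"
      using summable_on_reindex_bij_betw[OF bij, of ?b] inner_summable x y by simp
    show "sum ?a {0, 1} = (\<Sum>n\<in>{0, 1}. ?b (n - 1))"
      using x y by (simp add: dec_dil dec_dil_adj adj_pair_inner[OF T] adj_pair_inner[OF T']
          adj_pair_inner[OF D] adj_pair_inner[OF E])
    show "?a summable_on UNIV" using x y by (intro inner_summable) auto
  qed (auto simp: dec_dil dec_dil_adj)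
  also have "\<dots> = infsum ?b UNIV" by (rule infsum_reindex_bij_betw[OF bij])
  finally show ?thesis by (simp add: inner_l2)
qed

lemma dil_unitary: "unitary_pair K dil dil_adj"
proof -
  have "dil (dil_adj z) = z \<and> dil_adj (dil z) = z" if z: "z \<in> hcarrier K" for z
  proof (intro conjI dec_eqI)
    fix n
    have d [simp]: "dec z n \<in> hcarrier V" for n using z by simp
    have "hadd V (T (dec (dil_adj z) 0)) (E (dec (dil_adj z) (- 1))) = dec z 0"
      by (rule inner_eqI) (simp_all add: dec_dil_adj ops_add ops_minus TD EE)
    moreover have "hminus V (D (dec (dil_adj z) 0)) (T' (dec (dil_adj z) (- 1))) = dec z 1"
      by (rule inner_eqI) (simp_all add: dec_dil_adj ops_add ops_minus T'E DD)
    ultimately show "dec (dil (dil_adj z)) n = dec z n"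
      by (simp add: dec_dil[of "dil_adj z"]) (simp add: dec_dil_adj)
    have "hadd V (T' (dec (dil z) 0)) (D (dec (dil z) 1)) = dec z 0"
      by (rule inner_eqI) (simp_all add: dec_dil ops_add ops_minus T'E DD)
    moreover have "hminus V (E (dec (dil z) 0)) (T (dec (dil z) 1)) = dec z (- 1)"
      by (rule inner_eqI) (simp_all add: dec_dil ops_add ops_minus TD EE)
    ultimately show "dec (dil_adj (dil z)) n = dec z n"
      by (simp add: dec_dil_adj[of "dil z"]) (simp add: dec_dil)
  qed
  then show ?thesis by (simp add: unitary_pair_def adj_pair_def dil_adjoint)
qed

text \<open>Away from the matrix block, \<open>dil\<close> moves an entry from n - 1 to n, so
  \<open>c (n - 1) = r * c n\<close> is forced. The same recursion works in the block:
  \<open>D\<close> and \<open>E\<close> contribute no phase, so the weights supply it, and the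
  conjugate phase of \<open>T'\<close> is absorbed because \<open>c (-1)\<close> and
  \<open>c 1\<close> differ by two factors of \<open>r\<close>.\<close>

lemma dil_diag_op:
  assumes S: "adj_pair V S S'"
    and TS: "\<And>x. x \<in> hcarrier V \<Longrightarrow> T (S x) = hscale V r (S (T x))"
    and T'S: "\<And>x. x \<in> hcarrier V \<Longrightarrow> T' (S x) = hscale V (cnj r) (S (T' x))"
    and DS: "\<And>x. x \<in> hcarrier V \<Longrightarrow> D (S x) = S (D x)"
    and ES: "\<And>x. x \<in> hcarrier V \<Longrightarrow> E (S x) = S (E x)"
    and r: "cmod r = 1" and c: "\<And>n. c n = r * c (n + 1)"
    and z: "z \<in> hcarrier K"
  shows "dil (diag_op c S z) = hscale K r (diag_op c S (dil z))"
proof (rule dec_eqI)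
  fix n
  have d [simp]: "dec z n \<in> hcarrier V" for n using z by simp
  note S_in [simp] = adj_pair_in(1)[OF S]
  have rr: "r * cnj r = 1" using r by (rule unit_cnj)
  have c1: "c (-1) = r * c 0" and c0: "c 0 = r * c 1" using c[of "-1"] c[of 0] by simp_all
  have c': "c (-1) * cnj r = c 0" using rr by (simp add: c1 mult.commute mult.left_commute)
  have "hadd V (T (hscale V (c 0) (S (dec z 0)))) (E (hscale V (c (-1)) (S (dec z (-1)))))
      = hscale V (r * c 0) (S (hadd V (T (dec z 0)) (E (dec z (-1)))))"
    by (rule inner_eqI) (simp_all add: ops_scale TS ES adj_pair_add[OF S] c1 algebra_simps)
  moreover have "hminus V (D (hscale V (c 0) (S (dec z 0)))) (T' (hscale V (c (-1)) (S (dec z (-1)))))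
      = hscale V (r * c 1) (S (hminus V (D (dec z 0)) (T' (dec z (-1)))))"
    unfolding c0[symmetric]
    by (rule inner_eqI) (simp_all add: ops_scale T'S DS adj_pair_minus[OF S] c'[symmetric] algebra_simps)
  ultimately show "dec (dil (diag_op c S z)) n = dec (hscale K r (diag_op c S (dil z))) n"
    using c[of "n - 1"] by (simp add: dec_dil scale_scale)
qed

text \<open>The induction must know more than coordinate 0: powers of \<open>dil\<close> keep all
  negative coordinates zero, so \<open>E\<close> never contributes to coordinate 0; for
  \<open>dil_adj\<close> the positive coordinates play this role with \<open>D\<close>.\<close>

lemma dil_pow_emb:
  assumes x: "x \<in> hcarrier V"
  shows "dec ((dil ^^ n) (emb x)) 0 = (T ^^ n) x"
    and "dec ((dil_adj ^^ n) (emb x)) 0 = (T' ^^ n) x"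
proof -
  have "dec ((dil ^^ n) (emb x)) 0 = (T ^^ n) x \<and> (\<forall>i<0. dec ((dil ^^ n) (emb x)) i = hzero V)"
  proof (induction n)
    case (Suc n)
    have "(T ^^ n) x \<in> hcarrier V" by (rule funpow_in[OF adj_pair_in(1)[OF T] x])
    then show ?case using Suc by (auto simp: dec_dil ops_zero add_zero)
  qed simp
  then show "dec ((dil ^^ n) (emb x)) 0 = (T ^^ n) x" by simp
  have "dec ((dil_adj ^^ n) (emb x)) 0 = (T' ^^ n) x \<and> (\<forall>i>0. dec ((dil_adj ^^ n) (emb x)) i = hzero V)"
  proof (induction n)
    case (Suc n)
    have "(T' ^^ n) x \<in> hcarrier V" by (rule funpow_in[OF adj_pair_in(1)[OF T'] x])
    then show ?case using Suc by (auto simp: dec_dil_adj ops_zero add_zero)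
  qed simp
  then show "dec ((dil_adj ^^ n) (emb x)) 0 = (T' ^^ n) x" by simp
qed

end

section \<open>Dilating a q-commuting family\<close>

text \<open>The counterpart of \<open>opow\<close> with an explicit adjoint, so that the induction
  can avoid \<open>hadj\<close>.\<close>

definition pair_pow :: "('a \<Rightarrow> 'a) \<Rightarrow> ('a \<Rightarrow> 'a) \<Rightarrow> int \<Rightarrow> 'a \<Rightarrow> 'a" where
  "pair_pow S S' m = (if 0 \<le> m then S ^^ nat m else S' ^^ nat (- m))"

text \<open>\<open>opprod\<close> over an arbitrary list of indices, so that induction can peel off
  the leftmost factor.\<close>

definition op_list_prod :: "nat list \<Rightarrow> (nat \<Rightarrow> 'a \<Rightarrow> 'a) \<Rightarrow> 'a \<Rightarrow> 'a" where
  "op_list_prod xs F = foldr (\<lambda>i acc. F i \<circ> acc) xs id"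

lemma op_list_prod_simps [simp]:
  "op_list_prod [] F x = x"
  "op_list_prod (i # xs) F x = F i (op_list_prod xs F x)"
  by (simp_all add: op_list_prod_def)

lemma op_list_prod_in:
  "(\<And>i x. i \<in> set xs \<Longrightarrow> x \<in> C \<Longrightarrow> F i x \<in> C) \<Longrightarrow> x \<in> C \<Longrightarrow> op_list_prod xs F x \<in> C"
  by (induction xs) auto

lemma op_list_prod_cong:
  assumes "\<And>i x. i \<in> set xs \<Longrightarrow> x \<in> C \<Longrightarrow> F i x \<in> C"
    and "\<And>i x. i \<in> set xs \<Longrightarrow> x \<in> C \<Longrightarrow> F i x = G i x" and "x \<in> C"
  shows "op_list_prod xs F x = op_list_prod xs G x"
  using assms
proof (induction xs)
  case (Cons i xs)
  then show ?case using op_list_prod_in[of xs C F x] by simp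
qed simp

lemma pair_pow_in: "adj_pair V S S' \<Longrightarrow> x \<in> hcarrier V \<Longrightarrow> pair_pow S S' m x \<in> hcarrier V"
  using funpow_in[of "hcarrier V" S x] funpow_in[of "hcarrier V" S' x]
  by (simp add: pair_pow_def adj_pair_in)

lemma (in inner_space) opow_eq_pair_pow:
  assumes S: "contr_pair V S S'" and x: "x \<in> hcarrier V"
  shows "opow V S m x = pair_pow S S' m x"
proof -
  have SS: "adj_pair V S S'" using S by (simp add: contr_pair_def)
  have "(hadj V S ^^ n) x = (S' ^^ n) x" for n
  proof (induction n)
    case (Suc n)
    have "(S' ^^ n) x \<in> hcarrier V" by (rule funpow_in[OF adj_pair_in(2)[OF SS] x])
    then show ?case using Suc hadj_eq[OF S] by simp
  qed simp
  then show ?thesis by (simp add: opow_def pair_pow_def)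
qed

text \<open>The relations are imposed on ordered pairs in both directions, so that any index may be
  the next one to dilate.\<close>

definition q_system :: "'a hspace \<Rightarrow> nat set \<Rightarrow> (nat \<Rightarrow> nat \<Rightarrow> complex) \<Rightarrow> (nat \<Rightarrow> 'a \<Rightarrow> 'a) \<Rightarrow> (nat \<Rightarrow> 'a \<Rightarrow> 'a) \<Rightarrow> bool" where
  "q_system V I r T A \<longleftrightarrow> (\<forall>i\<in>I. contr_pair V (T i) (A i)) \<and>
     (\<forall>i\<in>I. \<forall>j\<in>I. i \<noteq> j \<longrightarrow> (\<forall>x\<in>hcarrier V.
        T i (T j x) = hscale V (r i j) (T j (T i x)) \<and>
        T i (A j x) = hscale V (cnj (r i j)) (A j (T i x))))"

definition phases :: "nat set \<Rightarrow> (nat \<Rightarrow> nat \<Rightarrow> complex) \<Rightarrow> bool" where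
  "phases I r \<longleftrightarrow> (\<forall>i\<in>I. \<forall>j\<in>I. i \<noteq> j \<longrightarrow> cmod (r i j) = 1 \<and> r j i = cnj (r i j))"

context inner_space
begin

text \<open>The middle identity is the adjoint of the relation between \<open>S\<close> and
  \<open>R'\<close>; the other two arise by moving the unimodular scalar to the other side.\<close>

lemma q_commute_swap:
  assumes S: "adj_pair V S S'" and R: "adj_pair V R R'" and a: "cmod a = 1"
    and SR: "\<And>x. x \<in> hcarrier V \<Longrightarrow> S (R x) = hscale V a (R (S x))"
    and SR': "\<And>x. x \<in> hcarrier V \<Longrightarrow> S (R' x) = hscale V (cnj a) (R' (S x))"
    and x: "x \<in> hcarrier V"
  shows "R (S x) = hscale V (cnj a) (S (R x))" "R (S' x) = hscale V a (S' (R x))"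
    "S' (R x) = hscale V (cnj a) (R (S' x))"
proof -
  note S_in [simp] = adj_pair_in[OF S] and R_in [simp] = adj_pair_in[OF R]
  have aa: "cnj a * a = 1" using unit_cnj[OF a] by (simp add: mult.commute)
  show "R (S x) = hscale V (cnj a) (S (R x))" using x by (simp add: SR scale_scale aa scale_one)
  show RS': "R (S' x) = hscale V a (S' (R x))"
  proof (rule inner_eqI)
    fix y assume y: "y \<in> hcarrier V"
    have "hinner V (R (S' x)) y = hinner V x (S (R' y))"
      using x y by (simp add: adj_pair_inner[OF R] adj_pair_inner[OF adj_pair_sym[OF S]])
    also have "\<dots> = hinner V (hscale V a (S' (R x))) y"
      using x y by (simp add: SR' adj_pair_inner[OF R] adj_pair_inner[OF adj_pair_sym[OF S]])
    finally show "hinner V (R (S' x)) y = hinner V (hscale V a (S' (R x))) y" .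
  qed (use x in auto)
  show "S' (R x) = hscale V (cnj a) (R (S' x))" using x by (simp add: RS' scale_scale aa scale_one)
qed

lemma contr_pair_gram: assumes "contr_pair V S S'" shows "contr_pair V (\<lambda>x. S' (S x)) (\<lambda>x. S' (S x))"
proof -
  have S: "adj_pair V S S'" using assms by (simp add: contr_pair_def)
  have "hnorm V (S' (S x)) \<le> hnorm V x" if x: "x \<in> hcarrier V" for x
  proof -
    have "hnorm V (S' (S x)) \<le> hnorm V (S x)"
      using contr_pair_sym[OF assms] adj_pair_in(1)[OF S x] by (simp add: contr_pair_def)
    also have "\<dots> \<le> hnorm V x" using assms x by (simp add: contr_pair_def)
    finally show ?thesis .
  qed
  then show ?thesis
    using adj_pair_inner[OF S] adj_pair_inner[OF adj_pair_sym[OF S]] adj_pair_in[OF S]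
    by (simp add: contr_pair_def adj_pair_def)
qed

end

section \<open>One dilation step for the whole family\<close>

context l2_hilbert
begin

text \<open>The quantifier over \<open>S\<close> stands inside the existential because one choice of
  \<open>D\<close> and \<open>E\<close> must serve every other member of the family and its
  adjoint.\<close>

lemma dilation_exists:
  assumes T: "contr_pair V T A"
  shows "\<exists>D E. dilation V dec T A D E \<and> (\<forall>S S' r. adj_pair V S S' \<longrightarrow> cmod r = 1 \<longrightarrow>
     (\<forall>x\<in>hcarrier V. T (S x) = hscale V r (S (T x))) \<longrightarrow>
     (\<forall>x\<in>hcarrier V. A (S x) = hscale V (cnj r) (S (A x))) \<longrightarrow>
     (\<forall>x\<in>hcarrier V. D (S x) = S (D x) \<and> E (S x) = S (E x)))"
proof -
  note AT = contr_pair_gram[OF T] and TA = contr_pair_gram[OF contr_pair_sym[OF T]]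
  obtain D where D: "is_defect V (\<lambda>x. A (T x)) D" using defect_exists[OF AT] ..
  obtain E where E: "is_defect V (\<lambda>x. T (A x)) E" using defect_exists[OF TA] ..
  have adj: "adj_pair V T A" using T by (simp add: contr_pair_def)
  note T_in [simp] = adj_pair_in[OF adj]
  have "dilation V dec T A D E"
  proof unfold_locales
    show "T (D x) = E (T x)" if "x \<in> hcarrier V" for x
      by (rule defect_intertwine[OF AT D TA E adj _ that]) simp
  qed (use adj defect_adj[OF AT D] defect_adj[OF TA E] defect_square[OF AT D] defect_square[OF TA E] in auto)
  moreover have "D (S x) = S (D x) \<and> E (S x) = S (E x)"
    if S: "adj_pair V S S'" and r: "cmod r = 1"
      and TS: "\<forall>x\<in>hcarrier V. T (S x) = hscale V r (S (T x))"
      and AS: "\<forall>x\<in>hcarrier V. A (S x) = hscale V (cnj r) (S (A x))" and x: "x \<in> hcarrier V" for S S' r x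
  proof -
    note S_in [simp] = adj_pair_in[OF S]
    have rr: "r * cnj r = 1" "cnj r * r = 1" using unit_cnj[OF r] by (simp_all add: mult.commute)
    have "S (D x) = D (S x)"
      by (rule defect_intertwine[OF AT D AT D S _ x])
        (simp add: TS AS adj_pair_scale[OF adj_pair_sym[OF adj]] scale_scale rr scale_one)
    moreover have "S (E x) = E (S x)"
      by (rule defect_intertwine[OF TA E TA E S _ x])
        (simp add: TS AS adj_pair_scale[OF adj] scale_scale rr scale_one)
    ultimately show ?thesis by simp
  qed
  ultimately show ?thesis by blast
qed

lemma dilate_one:
  assumes sys: "q_system V I r T A" and ph: "phases I r" and i0: "i0 \<in> I"
  shows "\<exists>T' A'. q_system K I r T' A' \<and> unitary_pair K (T' i0) (A' i0) \<and>
    (\<forall>i\<in>I. unitary_pair V (T i) (A i) \<longrightarrow> unitary_pair K (T' i) (A' i)) \<and>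
    (\<forall>xs m. distinct xs \<longrightarrow> set xs \<subseteq> I \<longrightarrow> (\<forall>x\<in>hcarrier V. \<forall>y\<in>hcarrier V.
       hinner K (op_list_prod xs (\<lambda>i. pair_pow (T' i) (A' i) (m i)) (emb x)) (emb y)
       = hinner V (op_list_prod xs (\<lambda>i. pair_pow (T i) (A i) (m i)) x) y))"
proof -
  have cp: "contr_pair V (T i) (A i)" if "i \<in> I" for i using sys that by (simp add: q_system_def)
  then have adj: "adj_pair V (T i) (A i)" if "i \<in> I" for i using that by (simp add: contr_pair_def)
  have TT: "T i (T j x) = hscale V (r i j) (T j (T i x))" "T i (A j x) = hscale V (cnj (r i j)) (A j (T i x))"
    if "i \<in> I" "j \<in> I" "i \<noteq> j" "x \<in> hcarrier V" for i j x
    using sys that unfolding q_system_def by blast+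
  have r1: "cmod (r i j) = 1" "r j i = cnj (r i j)" if "i \<in> I" "j \<in> I" "i \<noteq> j" for i j
    using ph that unfolding phases_def by blast+
  obtain D E where "dilation V dec (T i0) (A i0) D E" and DE: "\<And>S S' r. adj_pair V S S' \<Longrightarrow> cmod r = 1 \<Longrightarrow>
     (\<forall>x\<in>hcarrier V. T i0 (S x) = hscale V r (S (T i0 x))) \<Longrightarrow>
     (\<forall>x\<in>hcarrier V. A i0 (S x) = hscale V (cnj r) (S (A i0 x))) \<Longrightarrow>
     (\<forall>x\<in>hcarrier V. D (S x) = S (D x) \<and> E (S x) = S (E x))"
    using dilation_exists[OF cp[OF i0]] by blast
  then interpret dilation V dec "T i0" "A i0" D E by blast
  \<comment> \<open>Conjugation inverts the unimodular \<open>r i0 i\<close>. \<open>phases\<close>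
    says nothing about \<open>r i0 i0\<close>; the default 1 keeps \<open>c1\<close> and
    \<open>c0\<close> free of exceptions.\<close>
  define c where "c i n = (if i = i0 then 1 else cnj (r i0 i) powi n)" for i n
  have c1: "cmod (c i n) = 1" if "i \<in> I" for i n
    using r1(1)[OF i0 that] by (simp add: c_def norm_power_int)
  have c0: "c i 0 = 1" for i by (simp add: c_def)
  have c_rec: "c i n = r i0 i * c i (n + 1)" if i: "i \<in> I" "i \<noteq> i0" for i n
  proof -
    have u: "r i0 i * cnj (r i0 i) = 1" using r1(1)[OF i0 i(1)] i(2) by (intro unit_cnj) auto
    then have "cnj (r i0 i) \<noteq> 0" by auto
    then have "r i0 i * c i (n + 1) = (r i0 i * cnj (r i0 i)) * c i n"
      using i(2) by (simp add: c_def power_int_add_1)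
    then show ?thesis using u by simp
  qed
  define T' where "T' i = (if i = i0 then dil else diag_op (c i) (T i))" for i
  define A' where "A' i = (if i = i0 then dil_adj else diag_op (\<lambda>n. cnj (c i n)) (A i))" for i
  have T'_i0: "T' i0 = dil" "A' i0 = dil_adj" by (simp_all add: T'_def A'_def)
  have T'_i: "T' i = diag_op (c i) (T i)" "A' i = diag_op (\<lambda>n. cnj (c i n)) (A i)" if "i \<noteq> i0" for i
    using that by (simp_all add: T'_def A'_def)
  have cp': "contr_pair K (T' i) (A' i)" if "i \<in> I" for i
    using l2.unitary_pair_contr[OF dil_unitary] diag_op_contr[OF cp[OF that], of "c i"] c1[OF that]
    by (cases "i = i0") (simp_all add: T'_i0 T'_i)
  then have adj': "adj_pair K (T' i) (A' i)" if "i \<in> I" for i using that by (simp add: contr_pair_def)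
  have rel0: "dil (T' j z) = hscale K (r i0 j) (T' j (dil z))"
    "dil (A' j z) = hscale K (cnj (r i0 j)) (A' j (dil z))"
    if j: "j \<in> I" "j \<noteq> i0" and z: "z \<in> hcarrier K" for j z
  proof -
    have r: "cmod (r i0 j) = 1" "cmod (cnj (r i0 j)) = 1" using r1(1)[OF i0 j(1)] j(2) by auto
    note TTj = TT[OF i0 j(1) j(2)[symmetric]]
    have AT: "A i0 (T j x) = hscale V (cnj (r i0 j)) (T j (A i0 x))" if "x \<in> hcarrier V" for x
      using q_commute_swap(3)[OF T adj[OF j(1)] r(1) TTj that] by simp
    \<comment> \<open>\<open>A j\<close> takes the role of the second operator, with
      \<open>T j\<close> as its adjoint and the conjugate phase.\<close>
    have AA: "A i0 (A j x) = hscale V (cnj (cnj (r i0 j))) (A j (A i0 x))" if "x \<in> hcarrier V" for x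
      using q_commute_swap(3)[OF T adj_pair_sym[OF adj[OF j(1)]] r(2) TTj(2) _ that] TTj(1) by simp
    have DT: "D (T j x) = T j (D x) \<and> E (T j x) = T j (E x)" if "x \<in> hcarrier V" for x
      using DE[OF adj[OF j(1)] r(1)] TTj(1) AT that by blast
    have DA: "D (A j x) = A j (D x) \<and> E (A j x) = A j (E x)" if "x \<in> hcarrier V" for x
      using DE[OF adj_pair_sym[OF adj[OF j(1)]] r(2)] TTj(2) AA that by blast
    show "dil (T' j z) = hscale K (r i0 j) (T' j (dil z))"
      unfolding T'_i[OF j(2)]
      by (rule dil_diag_op[where c = "c j", OF adj[OF j(1)] _ _ _ _ r(1) c_rec[OF j] z]) (use TTj AT DT in auto)
    show "dil (A' j z) = hscale K (cnj (r i0 j)) (A' j (dil z))"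
      unfolding T'_i[OF j(2)]
    proof (rule dil_diag_op[where c = "\<lambda>n. cnj (c j n)", OF adj_pair_sym[OF adj[OF j(1)]] _ _ _ _ r(2) _ z])
      show "cnj (c j n) = cnj (r i0 j) * cnj (c j (n + 1))" for n
        by (subst c_rec[OF j]) simp
    qed (use TTj AA DA in auto)
  qed
  have rel: "T' i (T' j z) = hscale K (r i j) (T' j (T' i z)) \<and>
      T' i (A' j z) = hscale K (cnj (r i j)) (A' j (T' i z))"
    if i: "i \<in> I" and j: "j \<in> I" and ij: "i \<noteq> j" and z: "z \<in> hcarrier K" for i j z
  proof -
    consider "i = i0" | "j = i0" "i \<noteq> i0" | "i \<noteq> i0" "j \<noteq> i0" by blast
    then show ?thesis
    proof cases
      case 1
      then show ?thesis using rel0[OF j] ij z by (simp add: T'_i0)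
    next
      case 2
      have r: "cmod (r i0 i) = 1" "r i i0 = cnj (r i0 i)" using r1[OF i0 i] 2 by auto
      note sw = l2.q_commute_swap[OF adj'[OF i0] adj'[OF i] r(1) _ _ z]
      show ?thesis using sw(1,2) rel0[OF i 2(2)] by (simp add: 2 T'_i0 r(2))
    next
      case 3
      show ?thesis unfolding T'_i[OF 3(1)] T'_i[OF 3(2)]
        using diag_op_commute[OF adj[OF i] adj[OF j] TT(1)[OF i j ij] z]
          diag_op_commute[OF adj[OF i] adj_pair_sym[OF adj[OF j]] TT(2)[OF i j ij] z] by simp
    qed
  qed
  have sys': "q_system K I r T' A'" unfolding q_system_def using cp' rel by blast
  have uni: "unitary_pair K (T' i) (A' i)" if "i \<in> I" "unitary_pair V (T i) (A i)" for i
    using dil_unitary diag_op_unitary[OF that(2), of "c i"] c1[OF that(1)]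
    by (cases "i = i0") (simp_all add: T'_i0 T'_i)
  have diag_pow_emb: "(diag_op d S ^^ n) (emb x) = emb ((S ^^ n) x)"
    if "adj_pair V S S'" "d 0 = 1" "x \<in> hcarrier V" for d S S' n x
  proof (induction n)
    case (Suc n)
    have "(S ^^ n) x \<in> hcarrier V" by (rule funpow_in[OF adj_pair_in(1)[OF that(1)] that(3)])
    then show ?case using Suc diag_op_emb[where c = d, OF that(1,2)] by simp
  qed simp
  have diag_pow_dec: "dec ((diag_op d S ^^ n) z) 0 = (S ^^ n) (dec z 0)"
    if "adj_pair V S S'" "d 0 = 1" "z \<in> hcarrier K" for d S S' n z
  proof (induction n)
    case (Suc n)
    have "(S ^^ n) (dec z 0) \<in> hcarrier V"
      by (rule funpow_in[OF adj_pair_in(1)[OF that(1)] dec_in[OF that(3)]])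
    then show ?case using Suc adj_pair_in(1)[OF that(1)] that(2) by (simp add: scale_one)
  qed simp
  let ?F = "\<lambda>m i. pair_pow (T i) (A i) (m i)" and ?F' = "\<lambda>m i. pair_pow (T' i) (A' i) (m i)"
  have F_in: "op_list_prod xs (?F m) x \<in> hcarrier V" if "set xs \<subseteq> I" "x \<in> hcarrier V" for xs m x
    using that pair_pow_in[OF adj] by (intro op_list_prod_in) auto
  have F'_in: "op_list_prod xs (?F' m) z \<in> hcarrier K" if "set xs \<subseteq> I" "z \<in> hcarrier K" for xs m z
    using that pair_pow_in[OF adj'] by (intro op_list_prod_in) auto
  have compress_emb: "op_list_prod xs (?F' m) (emb x) = emb (op_list_prod xs (?F m) x)"
    if "set xs \<subseteq> I" "i0 \<notin> set xs" "x \<in> hcarrier V" for xs m x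
    using that
  proof (induction xs)
    case (Cons i xs)
    then have i: "i \<in> I" "i \<noteq> i0" by auto
    show ?case
      using Cons diag_pow_emb[where d = "c i" and x = "op_list_prod xs (?F m) x", OF adj[OF i(1)] c0] F_in[of xs x m]
        diag_pow_emb[where d = "\<lambda>n. cnj (c i n)" and x = "op_list_prod xs (?F m) x", OF adj_pair_sym[OF adj[OF i(1)]]]
      by (simp add: pair_pow_def T'_i[OF i(2)] c0)
  qed simp
  have compress: "dec (op_list_prod xs (?F' m) (emb x)) 0 = op_list_prod xs (?F m) x"
    if "distinct xs" "set xs \<subseteq> I" "x \<in> hcarrier V" for xs m x
    using that
  proof (induction xs)
    case (Cons i xs)
    then have i: "i \<in> I" and IH: "dec (op_list_prod xs (?F' m) (emb x)) 0 = op_list_prod xs (?F m) x" by auto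
    show ?case
    proof (cases "i = i0")
      \<comment> \<open>Distinctness enters here: \<open>i0\<close> does not recur in
        \<open>xs\<close>, so the remaining product still lies in the embedded copy, where powers of
        the dilation compress correctly.\<close>
      case True
      then show ?thesis
        using Cons compress_emb[of xs x m] dil_pow_emb[OF F_in[of xs x m]] by (simp add: pair_pow_def T'_i0)
    next
      case False
      have z: "op_list_prod xs (?F' m) (emb x) \<in> hcarrier K" using Cons by (intro F'_in) auto
      show ?thesis
        using IH diag_pow_dec[where d = "c i", OF adj[OF i] c0 z] diag_pow_dec[where d = "\<lambda>n. cnj (c i n)", OF adj_pair_sym[OF adj[OF i]] _ z]
        by (simp add: pair_pow_def T'_i[OF False] c0)
    qed
  qed simp
  have "hinner K (op_list_prod xs (?F' m) (emb x)) (emb y) = hinner V (op_list_prod xs (?F m) x) y"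
    if "distinct xs" "set xs \<subseteq> I" "x \<in> hcarrier V" "y \<in> hcarrier V" for xs m x y
    using inner_emb[OF F'_in[OF that(2) emb_in[OF that(3)]] that(4)] compress[OF that(1-3)] by simp
  then show ?thesis using sys' uni dil_unitary T'_i0 by - (rule exI[of _ T'], rule exI[of _ A'], auto)
qed

end

text \<open>The weak form of the dilation identity composes along chains of embeddings.\<close>
definition compresses :: "nat set \<Rightarrow> 'a hspace \<Rightarrow> (nat \<Rightarrow> 'a \<Rightarrow> 'a) \<Rightarrow> (nat \<Rightarrow> 'a \<Rightarrow> 'a)
    \<Rightarrow> 'b hspace \<Rightarrow> (nat \<Rightarrow> 'b \<Rightarrow> 'b) \<Rightarrow> (nat \<Rightarrow> 'b \<Rightarrow> 'b) \<Rightarrow> ('a \<Rightarrow> 'b) \<Rightarrow> bool" where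
  "compresses I V T A K T' A' J \<longleftrightarrow> (\<forall>xs m. distinct xs \<longrightarrow> set xs \<subseteq> I \<longrightarrow> (\<forall>x\<in>hcarrier V. \<forall>y\<in>hcarrier V.
       hinner K (op_list_prod xs (\<lambda>i. pair_pow (T' i) (A' i) (m i)) (J x)) (J y)
       = hinner V (op_list_prod xs (\<lambda>i. pair_pow (T i) (A i) (m i)) x) y))"

lemma isometric_embedding_comp:
  "isometric_embedding V K J \<Longrightarrow> isometric_embedding K L J' \<Longrightarrow> isometric_embedding V L (\<lambda>x. J' (J x))"
  by (simp add: isometric_embedding_def)

lemma compresses_comp:
  "isometric_embedding V K J \<Longrightarrow> compresses I V T A K T' A' J \<Longrightarrow> compresses I K T' A' L T'' A'' J'
    \<Longrightarrow> compresses I V T A L T'' A'' (\<lambda>x. J' (J x))"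
  by (simp add: compresses_def isometric_embedding_def)

text \<open>Source and target types are independent apart from \<open>dec\<close>, so the same
  statement covers the initial change of type and the later steps within one type.\<close>

lemma dilate_step:
  fixes V :: "'a hspace" and dec :: "'b \<Rightarrow> int \<Rightarrow> 'a"
  assumes "hilbert V" "bij dec" "q_system V I r T A" "phases I r" "i0 \<in> I"
  shows "\<exists>(K :: 'b hspace) J T' A'. hilbert K \<and> isometric_embedding V K J \<and> q_system K I r T' A' \<and>
    (\<forall>i\<in>I. i = i0 \<or> unitary_pair V (T i) (A i) \<longrightarrow> unitary_pair K (T' i) (A' i)) \<and>
    compresses I V T A K T' A' J"
proof -
  interpret hilbert V by fact
  interpret l2_hilbert V dec by unfold_locales fact
  obtain T' A' where *: "q_system K I r T' A'" "unitary_pair K (T' i0) (A' i0)"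
    "\<forall>i\<in>I. unitary_pair V (T i) (A i) \<longrightarrow> unitary_pair K (T' i) (A' i)" "compresses I V T A K T' A' emb"
    unfolding compresses_def using dilate_one[OF assms(3-5)] by blast
  have "hilbert K" by unfold_locales
  then show ?thesis using * emb_isometric by - (rule exI[of _ K], rule exI[of _ emb], rule exI[of _ T'], rule exI[of _ A'], auto)
qed

lemma dilate_list:
  fixes V :: "'b hspace" and dec :: "'b \<Rightarrow> int \<Rightarrow> 'b"
  assumes "bij dec" "phases I r" "hilbert V" "q_system V I r T A" "set js \<subseteq> I"
  shows "\<exists>(K :: 'b hspace) J T' A'. hilbert K \<and> isometric_embedding V K J \<and> q_system K I r T' A' \<and>
    (\<forall>i\<in>I. i \<in> set js \<or> unitary_pair V (T i) (A i) \<longrightarrow> unitary_pair K (T' i) (A' i)) \<and>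
    compresses I V T A K T' A' J"
  using assms(3-)
proof (induction js arbitrary: V T A)
  case Nil
  have "isometric_embedding V V (\<lambda>x. x)" "compresses I V T A V T A (\<lambda>x. x)"
    by (simp_all add: isometric_embedding_def compresses_def)
  then show ?case using Nil by - (rule exI[of _ V], rule exI[of _ "\<lambda>x. x"], rule exI[of _ T], rule exI[of _ A], simp)
next
  case (Cons j js)
  then have "j \<in> I" by simp
  from dilate_step[OF Cons.prems(1) assms(1) Cons.prems(2) assms(2) this]
  obtain K :: "'b hspace" and J T' A' where K: "hilbert K" "isometric_embedding V K J" "q_system K I r T' A'"
    "\<forall>i\<in>I. i = j \<or> unitary_pair V (T i) (A i) \<longrightarrow> unitary_pair K (T' i) (A' i)"
    "compresses I V T A K T' A' J" by blast
  from Cons.IH[OF K(1,3)] Cons.prems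
  obtain L :: "'b hspace" and J' T'' A'' where L: "hilbert L" "isometric_embedding K L J'" "q_system L I r T'' A''"
    "\<forall>i\<in>I. i \<in> set js \<or> unitary_pair K (T' i) (A' i) \<longrightarrow> unitary_pair L (T'' i) (A'' i)"
    "compresses I K T' A' L T'' A'' J'" by auto
  show ?case
    using L K isometric_embedding_comp[OF K(2) L(2)] compresses_comp[OF K(2,5) L(5)]
    by - (rule exI[of _ L], rule exI[of _ "\<lambda>x. J' (J x)"], rule exI[of _ T''], rule exI[of _ A''], auto)
qed

section \<open>Index codings, the orthogonal complement and the final assembly\<close>

lemma bij_int_encode_fun: "bij (\<lambda>(z :: nat \<Rightarrow> 'h) (n :: int). z (int_encode n))"
  by (rule o_bij[where g = "\<lambda>f m. f (int_decode m)"]) (auto simp: fun_eq_iff)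

text \<open>Pairing the integer index with the natural one makes integer-indexed sequences over
  \<open>nat \<Rightarrow> 'h\<close> fit into \<open>nat \<Rightarrow> 'h\<close> again, which
  closes the iteration.\<close>

lemma bij_prod_encode_fun:
  "bij (\<lambda>(z :: nat \<Rightarrow> 'h) (n :: int) (m :: nat). z (prod_encode (int_encode n, m)))"
  by (rule o_bij[where g = "\<lambda>f p. f (int_decode (fst (prod_decode p))) (snd (prod_decode p))"])
    (auto simp: fun_eq_iff)

lemma inner_space_perp:
  assumes "inner_space K" "S \<subseteq> hcarrier K" shows "inner_space (perp_space K S)"
proof -
  interpret inner_space K by fact
  have "s \<in> hcarrier K" if "s \<in> S" for s using assms(2) that by auto
  then show ?thesis
    by unfold_locales
      (auto simp: perp_space_def hminus_def inner_nonneg intro: inner_sym eq_if_dist_zero[unfolded hminus_def])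
qed

theorem theorem3p5:
  fixes H :: "'h hspace" and k :: nat
    and T :: "nat \<Rightarrow> ('h \<Rightarrow> 'h)" and q :: "nat \<Rightarrow> nat \<Rightarrow> complex"
  assumes H: "hilbert_space H"
    and contr: "\<forall>i\<in>{1..k}. contraction H (T i)"
    and qT: "\<forall>i j. 1 \<le> i \<and> i < j \<and> j \<le> k \<longrightarrow> cmod (q i j) = 1"
    and qc1: "\<forall>i j. 1 \<le> i \<and> i < j \<and> j \<le> k \<longrightarrow>
               (\<forall>x\<in>hcarrier H. T i (T j x) = hscale H (q i j) (T j (T i x)))"
    and qc2: "\<forall>i j. 1 \<le> i \<and> i < j \<and> j \<le> k \<longrightarrow>
               (\<forall>x\<in>hcarrier H. T i (hadj H (T j) x) = hscale H (cnj (q i j)) (hadj H (T j) (T i x)))"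
  shows "\<exists>(K :: (nat \<Rightarrow> 'h) hspace) J Q U.
     hilbert_space K \<and> isometric_embedding H K J \<and>
     (\<forall>i j. 1 \<le> i \<and> i < j \<and> j \<le> k \<longrightarrow> unitary K (Q i j)) \<and>
     (\<forall>i j i' j'. 1 \<le> i \<and> i < j \<and> j \<le> k \<and> 1 \<le> i' \<and> i' < j' \<and> j' \<le> k \<longrightarrow>
        (\<forall>z\<in>hcarrier K. Q i j (Q i' j' z) = Q i' j' (Q i j z))) \<and>
     (\<forall>i\<in>{1..k}. unitary K (U i)) \<and>
     (\<forall>i j. 1 \<le> i \<and> i < j \<and> j \<le> k \<longrightarrow>
        (\<forall>z\<in>hcarrier K. U i (U j z) = Q i j (U j (U i z)))) \<and>
     (\<forall>i j m. 1 \<le> i \<and> i < j \<and> j \<le> k \<and> m \<in> {1..k} \<longrightarrow>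
        (\<forall>z\<in>hcarrier K. Q i j (U m z) = U m (Q i j z))) \<and>
     (\<forall>m :: nat \<Rightarrow> int. \<forall>x\<in>hcarrier H.
        J (opprod k (\<lambda>i. opow H (T i) (m i)) x)
          = hproj K (J ` hcarrier H) (opprod k (\<lambda>i. opow K (U i) (m i)) (J x))) \<and>
     (\<forall>i j. 1 \<le> i \<and> i < j \<and> j \<le> k \<longrightarrow>
        (\<forall>x\<in>hcarrier H. Q i j (J x) = hscale K (q i j) (J x)) \<and>
        unitary (perp_space K (J ` hcarrier H)) (Q i j))"
proof -
  interpret H: hilbert H using H by (rule hilbert_space_imp_hilbert)
  \<comment> \<open>The identity is added at index \<open>0\<close>: dilating it first moves \<open>H\<close> into the
    type \<open>nat \<Rightarrow> 'h\<close>, also when \<open>k = 0\<close>.\<close>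
  let ?I = "{0..k}" and ?P = "{1..k}"
  define T0 where "T0 i = (if i = 0 then id else T i)" for i
  define A0 where "A0 i = (if i = 0 then id else hadj H (T i))" for i
  \<comment> \<open>The given phases cover i < j; reversed pairs get the conjugate, in accordance
    with \<open>q_commute_swap\<close>, and the identity at index 0 commutes with phase 1.\<close>
  define r where "r i j = (if i = 0 \<or> j = 0 then 1 else if i < j then q i j else cnj (q j i))" for i j
  have T0: "T0 0 = id" "A0 0 = id" "\<And>i. i \<in> ?P \<Longrightarrow> T0 i = T i" "\<And>i. i \<in> ?P \<Longrightarrow> A0 i = hadj H (T i)"
    by (auto simp: T0_def A0_def)
  have cp: "contr_pair H (T i) (hadj H (T i))" if "i \<in> ?P" for i
    using contr that by (intro H.contraction_contr_pair) auto
  then have adj: "adj_pair H (T i) (hadj H (T i))" if "i \<in> ?P" for i using that by (simp add: contr_pair_def)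
  have phases: "phases ?I r"
    unfolding phases_def using qT by (auto simp: r_def)
  have rel: "T0 i (T0 j x) = hscale H (r i j) (T0 j (T0 i x)) \<and>
      T0 i (A0 j x) = hscale H (cnj (r i j)) (A0 j (T0 i x))"
    if i: "i \<in> ?I" and j: "j \<in> ?I" and ij: "i \<noteq> j" and x: "x \<in> hcarrier H" for i j x
  proof -
    consider "i = 0" "j \<in> ?P" | "j = 0" "i \<in> ?P" | "i \<in> ?P" "j \<in> ?P" "i < j" | "i \<in> ?P" "j \<in> ?P" "j < i"
      using i j ij by fastforce
    then show ?thesis
    proof cases
      case 1
      then show ?thesis using adj_pair_in[OF adj x] by (simp add: T0 r_def H.scale_one)
    next
      case 2
      then show ?thesis using adj_pair_in[OF adj x] by (simp add: T0 r_def H.scale_one)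
    next
      case 3
      then show ?thesis using qc1 qc2 x by (simp add: T0 r_def)
    next
      case 4
      have "cmod (q j i) = 1"
        "\<And>x. x \<in> hcarrier H \<Longrightarrow> T j (T i x) = hscale H (q j i) (T i (T j x))"
        "\<And>x. x \<in> hcarrier H \<Longrightarrow> T j (hadj H (T i) x) = hscale H (cnj (q j i)) (hadj H (T i) (T j x))"
        using qT qc1 qc2 4 by auto
      from H.q_commute_swap[OF adj[OF 4(2)] adj[OF 4(1)] this x]
      show ?thesis using 4 by (simp add: T0 r_def)
    qed
  qed
  have "contr_pair H (T0 i) (A0 i)" if "i \<in> ?I" for i
    using that cp[of i] by (cases "i = 0") (auto simp: T0 contr_pair_def adj_pair_def)
  then have sys: "q_system H ?I r T0 A0"
    unfolding q_system_def using rel by blast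
  have "0 \<in> ?I" by simp
  from dilate_step[OF H.hilbert_axioms bij_int_encode_fun sys phases this]
  obtain V :: "(nat \<Rightarrow> 'h) hspace" and J0 T1 A1 where V: "hilbert V" "isometric_embedding H V J0"
    "q_system V ?I r T1 A1" "compresses ?I H T0 A0 V T1 A1 J0" by blast
  have "set [1..<k+1] \<subseteq> ?I" by auto
  from dilate_list[OF bij_prod_encode_fun phases V(1,3) this]
  obtain K :: "(nat \<Rightarrow> 'h) hspace" and J1 U B where K: "hilbert K" "isometric_embedding V K J1" "q_system K ?I r U B"
    "\<forall>i\<in>?I. i \<in> set [1..<k+1] \<or> unitary_pair V (T1 i) (A1 i) \<longrightarrow> unitary_pair K (U i) (B i)"
    "compresses ?I V T1 A1 K U B J1" by blast
  interpret K: hilbert K by fact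
  define J where "J = (\<lambda>x. J1 (J0 x))"
  define Q where "Q i j = hscale K (q i j)" for i j
  have J: "isometric_embedding H K J" unfolding J_def by (rule isometric_embedding_comp[OF V(2) K(2)])
  have comp: "compresses ?I H T0 A0 K U B J" unfolding J_def by (rule compresses_comp[OF V(2,4) K(5)])
  have U: "unitary_pair K (U i) (B i)" if "i \<in> ?P" for i
  proof -
    have "i \<in> ?I" "i \<in> set [1..<k+1]" using that by auto
    then show ?thesis using K(4) by blast
  qed
  have Uadj: "adj_pair K (U i) (B i)" if "i \<in> ?P" for i using U[OF that] by (simp add: unitary_pair_def)
  have J_in: "J x \<in> hcarrier K" if "x \<in> hcarrier H" for x using J that by (simp add: isometric_embedding_def)
  have J_inner: "hinner K (J x) (J y) = hinner H x y" if "x \<in> hcarrier H" "y \<in> hcarrier H" for x y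
    using J that by (simp add: isometric_embedding_def)
  have J_minus: "hminus K (J x) (J y) = J (hminus H x y)" if "x \<in> hcarrier H" "y \<in> hcarrier H" for x y
    using J that by (simp add: isometric_embedding_def hminus_def)
  have dil: "J (opprod k (\<lambda>i. opow H (T i) (m i)) x)
      = hproj K (J ` hcarrier H) (opprod k (\<lambda>i. opow K (U i) (m i)) (J x))"
    if x: "x \<in> hcarrier H" for m x
  proof -
    \<comment> \<open>The list starts at 1, so the auxiliary identity at index 0 stays out of the
      product.\<close>
    let ?xs = "[1..<k+1]"
    let ?TH = "op_list_prod ?xs (\<lambda>i. pair_pow (T0 i) (A0 i) (m i)) x"
    let ?UK = "op_list_prod ?xs (\<lambda>i. pair_pow (U i) (B i) (m i)) (J x)"
    have xs: "i \<in> ?P" if "i \<in> set ?xs" for i using that by auto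
    have T_in: "opow H (T i) (m i) z \<in> hcarrier H" "opow H (T i) (m i) z = pair_pow (T0 i) (A0 i) (m i) z"
      if "i \<in> set ?xs" "z \<in> hcarrier H" for i z
      using H.opow_eq_pair_pow[OF cp[OF xs] that(2)] pair_pow_in[OF adj[OF xs] that(2)] that(1) T0(3,4)[OF xs]
      by simp_all
    have U_in: "opow K (U i) (m i) z \<in> hcarrier K" "opow K (U i) (m i) z = pair_pow (U i) (B i) (m i) z"
      if "i \<in> set ?xs" "z \<in> hcarrier K" for i z
      using K.opow_eq_pair_pow[OF K.unitary_pair_contr[OF U[OF xs]] that(2)] pair_pow_in[OF Uadj[OF xs] that(2)] that(1)
      by simp_all
    have eqH: "opprod k (\<lambda>i. opow H (T i) (m i)) x = ?TH"
      unfolding opprod_def op_list_prod_def[symmetric] using T_in x by (rule op_list_prod_cong)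
    have eqK: "opprod k (\<lambda>i. opow K (U i) (m i)) (J x) = ?UK"
      unfolding opprod_def op_list_prod_def[symmetric] using U_in J_in[OF x] by (rule op_list_prod_cong)
    have TH_in: "?TH \<in> hcarrier H"
      using T_in x by (intro op_list_prod_in) metis+
    have UK_in: "?UK \<in> hcarrier K"
      using U_in J_in[OF x] by (intro op_list_prod_in) metis+
    have "hproj K (J ` hcarrier H) ?UK = J ?TH"
    \<comment> \<open>The weak identities say that both vectors have the same inner products with
      the embedded copy, which characterises the projection.\<close>
    proof (rule K.hproj_eqI)
      fix s assume "s \<in> J ` hcarrier H"
      then obtain y where y: "y \<in> hcarrier H" "s = J y" by blast
      have "hinner K ?UK (J y) = hinner H ?TH y"
        using comp x y(1) distinct_upt[of 1 "k + 1"] \<open>set [1..<k+1] \<subseteq> ?I\<close> unfolding compresses_def by blast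
      then show "hinner K ?UK s = hinner K (J ?TH) s" using y TH_in by (simp add: J_inner)
    qed (use J_in J_minus UK_in TH_in in auto)
    then show ?thesis by (simp only: eqH eqK)
  qed
  have Q_unitary: "unitary K (Q i j)" "unitary (perp_space K (J ` hcarrier H)) (Q i j)"
    if "1 \<le> i \<and> i < j \<and> j \<le> k" for i j
  proof -
    have q: "cmod (q i j) = 1" using qT that by blast
    show "unitary K (Q i j)"
      unfolding Q_def by (rule K.unitary_pair_unitary[OF K.scalar_unitary_pair[OF q]])
    have "inner_space (perp_space K (J ` hcarrier H))"
      using J_in by (intro inner_space_perp K.inner_space_axioms) auto
    then interpret P: inner_space "perp_space K (J ` hcarrier H)" .
    \<comment> \<open>\<open>perp_space\<close> changes only the carrier, so scaling is the same
      function and the scalar argument applies verbatim on the complement.\<close>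
    have "Q i j = hscale (perp_space K (J ` hcarrier H)) (q i j)" by (simp add: Q_def perp_space_def)
    then show "unitary (perp_space K (J ` hcarrier H)) (Q i j)"
      using P.unitary_pair_unitary[OF P.scalar_unitary_pair[OF q]] by simp
  qed
  have UU: "U i (U j z) = Q i j (U j (U i z))" if "1 \<le> i \<and> i < j \<and> j \<le> k" "z \<in> hcarrier K" for i j z
  proof -
    have "i \<in> ?I" "j \<in> ?I" "i \<noteq> j" "r i j = q i j" using that by (auto simp: r_def)
    then show ?thesis using K(3) that(2) unfolding q_system_def Q_def by metis
  qed
  show ?thesis
  proof (rule exI[of _ K], rule exI[of _ J], rule exI[of _ Q], rule exI[of _ U], intro conjI allI impI ballI)
    fix i j i' j' z
    assume "z \<in> hcarrier K"
    then show "Q i j (Q i' j' z) = Q i' j' (Q i j z)"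
      by (simp add: Q_def K.scale_scale mult.commute)
  next
    fix i j m z
    assume "1 \<le> i \<and> i < j \<and> j \<le> k \<and> m \<in> {1..k}" "z \<in> hcarrier K"
    then show "Q i j (U m z) = U m (Q i j z)"
      using K.adj_pair_scale[OF Uadj] by (simp add: Q_def)
  next
    fix i assume "i \<in> {1..k}"
    then show "unitary K (U i)" by (rule K.unitary_pair_unitary[OF U])
  next
    show "hilbert_space K" by (rule K.hilbert_space)
  qed (use J dil Q_unitary UU in \<open>simp_all add: Q_def\<close>)
qed

end
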